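(* Let $\mathbb{X}$ be a Polish space, $\mathfrak{q},\mathfrak{q}_0$ two EPPFs and $H_0$ a probability measure on $\mathbb{X}$ (not necessarily diffuse). Let $[\xi_{i,j}]_{i=1,\dots,I,\,j\ge1}$ be a $HSSM(\mathfrak{q},\mathfrak{q}_0,H_0)$, let $n_1,\dots,n_I$ be positive integers, and set $\mathcal{O}:=\{\xi_{i,j}:j=1,\dots,n_i;\ i=1,\dots,I\}$. Let $(\phi_n)_n$ be a sequence of i.i.d. random variables with distribution $H_0$, $\Pi^{(1)},\dots,\Pi^{(I)}$ i.i.d. exchangeable random partitions of $\mathbb{N}$ with EPPF $\mathfrak{q}$, and $\Pi^{(0)}$ an exchangeable random partition of $\mathbb{N}$ with EPPF $\mathfrak{q}_0$, all these random elements being independent. Define $$c_{i,j}:=\mathscr{C}_j\big(\Pi^{(i)}\big),\qquad \mathscr{D}(i,c):=\sum_{i'=1}^{i-1}\big|\Pi^{(i')}_{n_{i'}}\big|+c,\qquad d^*_{i,j}:=\mathscr{C}_{\mathscr{D}(i,c_{i,j})}\big(\Pi^{(0)}\big).$$ Then the law of (the array) $\mathcal{O}$ is the same as the law of $[\phi_{d^*_{i,j}}:j=1,\dots,n_i;\ i=1,\dots,I]$.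
   Context: Partitions. $\mathcal{P}_n$ is the set of partitions of $\{1,\dots,n\}$, written $\pi_n=[\pi_{1,n},\dots,\pi_{k,n}]$ with blocks in increasing order of least element; $|\pi_n|=k$ is the number of blocks. An exchangeable random partition of $\mathbb{N}$ is a sequence $\Pi=(\Pi_n)_n$ of random partitions of $\{1,\dots,n\}$, consistent under restriction, each with permutation-invariant law; its EPPF is the symmetric function $\mathfrak{q}$ with $\mathbb{P}\{\Pi_n=\pi_n\}=\mathfrak{q}(|\pi_{1,n}|,\dots,|\pi_{k,n}|)=:\mathfrak{q}(\pi_n)$. $\mathscr{C}_j(\Pi)$ is the index $c$ of the block of $\Pi$ containing $j$ (i.e. $j\in\Pi_{c,n}$ for all $n\ge j$). $p\sim SSrp(\mathfrak{q}_0,H_0)$ means that $p=\sum_{j\ge1}\tilde q_j\delta_{Z_j}$, where $(Z_j)_j$ are i.i.d. with law $H_0$, independent of the nonnegative random weights $(\tilde q_j)_j$ with $\sum_j\tilde q_j=1$ a.s., and $\mathfrak{q}_0(n_1,\dots,n_k)=\sum_{j_1,\dots,j_k}\mathbb{E}\big[\prod_{i=1}^k\tilde q_{j_i}^{\,n_i}\big]$, the sum ranging over ordered $k$-tuples of distinct positive integers. An array $[\xi_{i,j}]_{i=1,\dots,I,\,j\ge1}$ of $\mathbb{X}$-valued random variables is a $HSSM(\mathfrak{q},\mathfrak{q}_0,H_0)$ if for every vector of positive integers $(n_1,\dots,n_I)$ and all Borel sets $A_{i,j}$, $$\mathbb{P}\{\xi_{i,j}\in A_{i,j},\ i=1,\dots,I,\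 j=1,\dots,n_i\}=\sum_{\pi^{(1)}_{n_1}\in\mathcal{P}_{n_1},\dots,\pi^{(I)}_{n_I}\in\mathcal{P}_{n_I}}\ \prod_{i=1}^I\mathfrak{q}\big(\pi^{(i)}_{n_i}\big)\ \mathbb{E}\Big[\prod_{i=1}^I\prod_{c=1}^{|\pi^{(i)}_{n_i}|}\tilde p\Big(\bigcap_{j\in\pi^{(i)}_{c,n_i}}A_{i,j}\Big)\Big],$$ with $\tilde p\sim SSrp(\mathfrak{q}_0,H_0)$. *)

theory Defs
  imports "HOL-Probability.Probability"
begin

definition partitions :: "nat \<Rightarrow> nat set set set" where
  "partitions n = {P. partition_on {1..n} P}"

definition blocks :: "nat set set \<Rightarrow> nat set list" where
  "blocks P = sorted_key_list_of_set Min P"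

(* Block numbers start at 1, list positions at 0. *)
definition block :: "nat set set \<Rightarrow> nat \<Rightarrow> nat set" where
  "block P c = blocks P ! (c - 1)"

definition block_sizes :: "nat set set \<Rightarrow> nat list" where
  "block_sizes P = map card (blocks P)"

(* The sequence \<open>P\<close> stands for a partition of the positive integers: \<open>P n\<close> is its
   restriction to \<open>{1..n}\<close>. The index is well defined when the sequence is consistent. *)
definition block_index :: "(nat \<Rightarrow> nat set set) \<Rightarrow> nat \<Rightarrow> nat" where
  "block_index P j = (THE c. \<forall>n\<ge>j. c \<in> {1..card (P n)} \<and> j \<in> block (P n) c)"

definition partition_space :: "(nat \<Rightarrow> nat set set) measure" where
  "partition_space = (\<Pi>\<^sub>M n\<in>UNIV. count_space (partitions n))"

(* The entry for \<open>n = 0\<close> carries no information: \<open>partitions 0 = {{}}\<close>. *)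
definition exchangeable_random_partition ::
    "'a measure \<Rightarrow> ('a \<Rightarrow> nat \<Rightarrow> nat set set) \<Rightarrow> bool" where
  "exchangeable_random_partition M R \<longleftrightarrow>
     R \<in> measurable M partition_space \<and>
     (\<forall>\<omega>\<in>space M. \<forall>m n. m \<le> n \<longrightarrow> R \<omega> m = (\<lambda>B. B \<inter> {1..m}) ` R \<omega> n - {{}}) \<and>
     (\<forall>n \<sigma>. \<sigma> permutes {1..n} \<longrightarrow>
        distr M (count_space (partitions n)) (\<lambda>\<omega>. (\<lambda>B. \<sigma> ` B) ` R \<omega> n) =
        distr M (count_space (partitions n)) (\<lambda>\<omega>. R \<omega> n))"

definition has_EPPF ::
    "'a measure \<Rightarrow> ('a \<Rightarrow> nat \<Rightarrow> nat set set) \<Rightarrow> (nat list \<Rightarrow> real) \<Rightarrow> bool" where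
  "has_EPPF M R q \<longleftrightarrow>
     exchangeable_random_partition M R \<and>
     (\<forall>ns ms. 0 \<notin> set ns \<longrightarrow> mset ms = mset ns \<longrightarrow> q ms = q ns) \<and>
     (\<forall>n\<ge>1. \<forall>P\<in>partitions n. measure M {\<omega> \<in> space M. R \<omega> n = P} = q (block_sizes P))"

(* The events generated by the random element \<open>X\<close> with values in \<open>N\<close>. Stated on
   sigma-algebras because \<open>indep_var\<close> and \<open>indep_vars\<close> need all random elements to take
   values in the same type. *)
definition gen_events :: "'a measure \<Rightarrow> 'b measure \<Rightarrow> ('a \<Rightarrow> 'b) \<Rightarrow> 'a set set" where
  "gen_events M N X = sets (vimage_algebra (space M) X N)"

(* \<open>p = (\<Sum>j. w j * \<delta>(Z j))\<close>; weights and atoms are indexed by all of \<open>nat\<close>, starting at 0. *)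
definition SSrp ::
    "'b measure \<Rightarrow> ('b \<Rightarrow> 'x measure) \<Rightarrow> (nat list \<Rightarrow> real) \<Rightarrow> 'x::topological_space measure \<Rightarrow> bool"
  where
  "SSrp N p q0 H0 \<longleftrightarrow>
     (\<exists>(w :: nat \<Rightarrow> 'b \<Rightarrow> real) (Z :: nat \<Rightarrow> 'b \<Rightarrow> 'x).
        (\<forall>j. w j \<in> borel_measurable N) \<and>
        (\<forall>j. \<forall>\<omega>\<in>space N. 0 \<le> w j \<omega>) \<and>
        (AE \<omega> in N. (\<lambda>j. w j \<omega>) sums 1) \<and>
        prob_space.indep_vars N (\<lambda>_. borel) Z UNIV \<and>
        (\<forall>j. distr N borel (Z j) = H0) \<and>
        prob_space.indep_set N
          (gen_events N (\<Pi>\<^sub>M j\<in>UNIV. borel) (\<lambda>\<omega> j. w j \<omega>))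
          (gen_events N (\<Pi>\<^sub>M j\<in>UNIV. borel) (\<lambda>\<omega> j. Z j \<omega>)) \<and>
        (\<forall>\<omega>\<in>space N. sets (p \<omega>) = sets borel \<and>
           (\<forall>A\<in>sets borel. emeasure (p \<omega>) A = (\<Sum>j. ennreal (w j \<omega>) * indicator A (Z j \<omega>)))) \<and>
        (\<forall>ns. ns \<noteq> [] \<longrightarrow> 0 \<notin> set ns \<longrightarrow>
           q0 ns = (\<Sum>\<^sub>\<infinity>js\<in>{js. length js = length ns \<and> distinct js}.
                      \<integral>\<omega>. (\<Prod>i<length ns. w (js ! i) \<omega> ^ (ns ! i)) \<partial>N)))"

(* The array lives on \<open>M\<close>; \<open>p\<close> is the species sampling random probability appearing in the
   mixed moments. It may live on another probability space \<open>N\<close>, since only its law matters. *)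
definition HSSM ::
    "'a measure \<Rightarrow> nat \<Rightarrow> (nat \<Rightarrow> nat \<Rightarrow> 'a \<Rightarrow> 'x) \<Rightarrow> 'b measure \<Rightarrow> ('b \<Rightarrow> 'x measure) \<Rightarrow>
     (nat list \<Rightarrow> real) \<Rightarrow> (nat list \<Rightarrow> real) \<Rightarrow> 'x::topological_space measure \<Rightarrow> bool" where
  "HSSM M I \<xi> N p q q0 H0 \<longleftrightarrow>
     SSrp N p q0 H0 \<and>
     (\<forall>i\<in>{1..I}. \<forall>j\<ge>1. \<xi> i j \<in> measurable M borel) \<and>
     (\<forall>(n :: nat \<Rightarrow> nat) (A :: nat \<Rightarrow> nat \<Rightarrow> 'x set).
        (\<forall>i\<in>{1..I}. 1 \<le> n i) \<longrightarrow> (\<forall>i j. A i j \<in> sets borel) \<longrightarrow>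
        measure M {\<omega> \<in> space M. \<forall>i\<in>{1..I}. \<forall>j\<in>{1..n i}. \<xi> i j \<omega> \<in> A i j} =
        (\<Sum>\<pi>\<in>(\<Pi>\<^sub>E i\<in>{1..I}. partitions (n i)).
           (\<Prod>i\<in>{1..I}. q (block_sizes (\<pi> i))) *
           (\<integral>\<omega>. (\<Prod>i\<in>{1..I}. \<Prod>B\<in>\<pi> i. measure (p \<omega>) (\<Inter>j\<in>B. A i j)) \<partial>N)))"

(* In the next two definitions \<open>\<pi> i\<close> with \<open>i \<ge> 1\<close> is a realisation of the random partition
   of group \<open>i\<close>, and \<open>\<pi> 0\<close> one of the random partition at the top level. *)

definition cell_index :: "(nat \<Rightarrow> nat) \<Rightarrow> (nat \<Rightarrow> nat \<Rightarrow> nat set set) \<Rightarrow> nat \<Rightarrow> nat \<Rightarrow> nat" where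
  "cell_index n \<pi> i c = (\<Sum>i'\<in>{1..<i}. card (\<pi> i' (n i'))) + c"

definition dstar :: "(nat \<Rightarrow> nat) \<Rightarrow> (nat \<Rightarrow> nat \<Rightarrow> nat set set) \<Rightarrow> nat \<Rightarrow> nat \<Rightarrow> nat" where
  "dstar n \<pi> i j = block_index (\<pi> 0) (cell_index n \<pi> i (block_index (\<pi> i) j))"

end

theory Submission
  imports Defs
begin

text \<open>
  Both laws are compared on rectangles. The moment formula
  \<open>E (\<Prod>k. p (D k)) = (\<Sum>P. q0 P * (\<Prod>B\<in>P. H0 (\<Inter>k\<in>B. D k)))\<close>, with \<open>P\<close> ranging over the
  partitions of \<open>{1..m}\<close>, comes from expanding the product of the series \<open>\<Sum>j. w j * 1 (Z j \<in> D k)\<close>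
  over all maps \<open>f\<close> from \<open>{1..m}\<close> to the atoms and grouping the maps by their partition into
  fibres: a map with fibre partition \<open>P\<close> is a choice of distinct atoms for the blocks of \<open>P\<close>.
  Applied to the array, with one \<open>k\<close> for each cell \<open>(i, c)\<close>, it turns the defining formula
  of the model into a sum over realisations of the group partitions and of the top-level partition. Conditioning
  the array \<open>\<phi> (d* i j)\<close> on these partitions gives the same sum, by independence.

  The number of cells depends on the group partitions. To work with one fixed level of the
  top-level partition, \<open>m\<close> is always the total sample size \<open>\<Sum>i. n i\<close>, and \<open>D k\<close> is the whole
  space for those \<open>k\<close> that are not the number of a cell.
\<close>

section \<open>Block numbers\<close>

text \<open>The facts on \<open>sorted_key_list_of_set\<close> come from a locale with a fixed set
  on which the key is injective. Taking \<open>S\<close> itself as this set covers keys such as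
  \<open>Min\<close>, which is injective on the blocks of a partition but not on all sets.\<close>

lemma (in linorder) sorted_key_list_of_set_inj_on:
  assumes "finite S" "inj_on f S"
  shows "set (sorted_key_list_of_set f S) = S"
    and "length (sorted_key_list_of_set f S) = card S"
    and "distinct (sorted_key_list_of_set f S)"
    and "sorted_wrt (<) (map f (sorted_key_list_of_set f S))"
proof -
  interpret folding_insort_key "(\<le>)" "(<)" S f
    by unfold_locales fact
  show "set (sorted_key_list_of_set f S) = S"
    "length (sorted_key_list_of_set f S) = card S"
    "distinct (sorted_key_list_of_set f S)"
    "sorted_wrt (<) (map f (sorted_key_list_of_set f S))"
    using assms(1) distinct_if_distinct_map[OF distinct_sorted_key_list_of_set[OF subset_refl]]
    by simp_all
qed

text \<open>The single-level counterpart of \<open>block_index\<close>: it looks at one finite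
  partition, so it can be computed before consistency across levels comes in.\<close>

definition block_number :: "nat set set \<Rightarrow> nat \<Rightarrow> nat" where
  "block_number P k = (THE c. c \<in> {1..card P} \<and> k \<in> block P c)"

lemma finite_partitions: "finite (partitions n)"
proof (rule finite_subset)
  show "partitions n \<subseteq> Pow (Pow {1..n})"
    by (auto simp: partitions_def partition_on_def)
qed simp

context
  fixes P :: "nat set set" and n :: nat
  assumes P: "P \<in> partitions n"
begin

lemma partitions_finite: "finite P"
  and partitions_Union: "\<Union>P = {1..n}"
  and partitions_disjoint: "\<And>A B. A \<in> P \<Longrightarrow> B \<in> P \<Longrightarrow> A \<inter> B \<noteq> {} \<Longrightarrow> A = B"
  and partitions_block_finite: "\<And>B. B \<in> P \<Longrightarrow> finite B"
  and partitions_block_nonempty: "\<And>B. B \<in> P \<Longrightarrow> B \<noteq> {}"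
proof -
  have part: "partition_on {1..n} P"
    using P by (simp add: partitions_def)
  show "finite P" using part by (rule finite_elements[rotated]) simp
  show U: "\<Union>P = {1..n}" using part by (rule partition_onD1[symmetric])
  show "A = B" if "A \<in> P" "B \<in> P" "A \<inter> B \<noteq> {}" for A B
    using partition_onD2[OF part] that by (auto simp: disjoint_def)
  show "finite B" if "B \<in> P" for B
    using U that by (intro finite_subset[of B "{1..n}"]) auto
  show "B \<noteq> {}" if "B \<in> P" for B
    using partition_onD3[OF part] that by auto
qed

lemma partitions_Min_in: "B \<in> P \<Longrightarrow> Min B \<in> B"
  using partitions_block_finite partitions_block_nonempty by (intro Min_in) auto

text \<open>Blocks with equal minima share that element. This makes \<open>Min\<close> an admissible
  sorting key for \<open>blocks\<close>.\<close>

lemma partitions_inj_on_Min: "inj_on Min P"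
  using partitions_Min_in partitions_disjoint by (metis disjoint_iff inj_onI)

lemma set_blocks: "set (blocks P) = P"
  and length_blocks: "length (blocks P) = card P"
  and distinct_blocks: "distinct (blocks P)"
  and strict_sorted_blocks: "sorted_wrt (<) (map Min (blocks P))"
  using sorted_key_list_of_set_inj_on[OF partitions_finite partitions_inj_on_Min]
  by (auto simp: blocks_def)

lemma bij_betw_block: "bij_betw (block P) {1..card P} P"
proof -
  have 1: "bij_betw (\<lambda>c. c - 1) {1..card P} {..<card P}"
    by (rule bij_betw_byWitness[where f' = Suc]) auto
  have 2: "bij_betw ((!) (blocks P)) {..<card P} P"
    using bij_betw_nth[OF distinct_blocks] by (simp add: set_blocks length_blocks)
  show ?thesis
    using bij_betw_trans[OF 1 2] by (simp add: block_def[abs_def] comp_def)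
qed

lemma block_in: "c \<in> {1..card P} \<Longrightarrow> block P c \<in> P"
  using bij_betw_block by (auto simp: bij_betw_def)

lemma block_inj:
  assumes "c \<in> {1..card P}" "d \<in> {1..card P}" "k \<in> block P c" "k \<in> block P d"
  shows "c = d"
proof -
  have "block P c = block P d"
    using assms by (intro partitions_disjoint block_in) auto
  then show ?thesis
    using assms bij_betw_imp_inj_on[OF bij_betw_block] by (auto dest: inj_onD)
qed

lemma ex1_block: "k \<in> {1..n} \<Longrightarrow> \<exists>!c. c \<in> {1..card P} \<and> k \<in> block P c"
proof -
  assume "k \<in> {1..n}"
  then obtain B where "B \<in> P" "k \<in> B"
    using partitions_Union by blast
  then have "\<exists>c. c \<in> {1..card P} \<and> k \<in> block P c"
    using bij_betw_imp_surj_on[OF bij_betw_block] by (metis imageE)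
  then show ?thesis
    using block_inj by (intro ex_ex1I) auto
qed

lemma block_number_in: "k \<in> {1..n} \<Longrightarrow> block_number P k \<in> {1..card P}"
  and block_number_block: "k \<in> {1..n} \<Longrightarrow> k \<in> block P (block_number P k)"
  using theI'[OF ex1_block] unfolding block_number_def by auto

lemma block_subset: "c \<in> {1..card P} \<Longrightarrow> block P c \<subseteq> {1..n}"
  using block_in partitions_Union by blast

lemma block_number_eq:
  assumes "c \<in> {1..card P}" "k \<in> block P c"
  shows "block_number P k = c"
proof -
  have "k \<in> {1..n}" using assms block_subset by blast
  then show ?thesis
    using block_number_in block_number_block assms by (intro block_inj)
qed

lemma in_block_iff:
  "c \<in> {1..card P} \<Longrightarrow> k \<in> block P c \<longleftrightarrow> k \<in> {1..n} \<and> block_number P k = c"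
  using block_number_block block_number_eq block_subset by (metis subsetD)

text \<open>The list \<open>blocks P\<close> is strictly sorted by minima, so the blocks counted
  here are exactly the first \<open>c\<close> ones.\<close>

lemma card_Min_le_block:
  assumes c: "c \<in> {1..card P}"
  shows "card {B \<in> P. Min B \<le> Min (block P c)} = c"
proof -
  have mono: "Min (block P d) < Min (block P e)" if "d < e" "d \<in> {1..card P}" "e \<in> {1..card P}" for d e
    using sorted_wrt_nth_less[OF strict_sorted_blocks, of "d - 1" "e - 1"] that
    by (auto simp: block_def length_blocks)
  have iff: "Min (block P d) \<le> Min (block P c) \<longleftrightarrow> d \<le> c" if "d \<in> {1..card P}" for d
    using mono[of d c] mono[of c d] that c by (cases d c rule: linorder_cases) auto
  have "{B \<in> P. Min B \<le> Min (block P c)} = block P ` {1..c}"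
  proof (intro equalityI subsetI)
    fix B assume B: "B \<in> {B \<in> P. Min B \<le> Min (block P c)}"
    then obtain d where "d \<in> {1..card P}" "B = block P d"
      using bij_betw_imp_surj_on[OF bij_betw_block] by (metis (lifting) imageE mem_Collect_eq)
    with B iff show "B \<in> block P ` {1..c}" by auto
  next
    fix B assume "B \<in> block P ` {1..c}"
    then show "B \<in> {B \<in> P. Min B \<le> Min (block P c)}"
      using block_in iff c by auto
  qed
  also have "card \<dots> = c"
    using c bij_betw_imp_inj_on[OF bij_betw_block]
    by (subst card_image) (auto elim: inj_on_subset)
  finally show ?thesis .
qed

text \<open>The minima of the blocks up to \<open>Min B\<close> survive restriction to any \<open>{1..m}\<close> that meets \<open>B\<close>,
  so this expression makes the number of a block independent of the level.\<close>

lemma block_number_conv_card: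
  assumes "B \<in> P" "k \<in> B"
  shows "block_number P k = card {A \<in> P. Min A \<le> Min B}"
proof -
  have "k \<in> {1..n}" using assms partitions_Union by auto
  then have c: "block_number P k \<in> {1..card P}" "k \<in> block P (block_number P k)"
    by (rule block_number_in block_number_block)+
  then have "block P (block_number P k) = B"
    using assms block_in partitions_disjoint by blast
  with card_Min_le_block[OF c(1)] show ?thesis by simp
qed

end

text \<open>Sending each block to its minimum is an injection into \<open>{1..n}\<close>.\<close>

lemma partitions_card_le:
  assumes P: "P \<in> partitions n"
  shows "card P \<le> n"
proof -
  have "Min ` P \<subseteq> {1..n}"
    using partitions_Min_in[OF P] partitions_Union[OF P] by blast
  then show ?thesis
    using card_image[OF partitions_inj_on_Min[OF P]] card_mono[of "{1..n}" "Min ` P"] by simp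
qed

section \<open>Block numbers under restriction to a lower level\<close>

lemma Min_Int_atLeastAtMost:
  fixes B :: "nat set"
  assumes "finite B" "B \<subseteq> {1..n}" "B \<inter> {1..m} \<noteq> {}"
  shows "Min (B \<inter> {1..m}) = Min B"
proof (rule antisym)
  have B: "B \<noteq> {}" using assms by auto
  \<comment> \<open>A point of the trace bounds \<open>Min B\<close> by \<open>m\<close>, so the
    minimum itself survives the restriction.\<close>
  obtain k where k: "k \<in> B" "k \<le> m" using assms by auto
  then have "Min B \<le> m" "Min B \<in> B" using Min_le[OF assms(1) k(1)] Min_in[OF assms(1) B] by auto
  then have "Min B \<in> B \<inter> {1..m}" using assms by auto
  then show "Min (B \<inter> {1..m}) \<le> Min B" using assms by (intro Min_le) auto
  show "Min B \<le> Min (B \<inter> {1..m})" using assms by (intro Min_antimono) auto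
qed

text \<open>Both block numbers count blocks by their minima. Taking traces on \<open>{1..m}\<close>
  is a bijection between the two sets of blocks counted, because it preserves the minima
  involved.\<close>

lemma block_number_restrict:
  assumes P: "P \<in> partitions n" and Q: "Q \<in> partitions m"
    and eq: "Q = (\<lambda>B. B \<inter> {1..m}) ` P - {{}}" and k: "k \<in> {1..m}" "k \<in> {1..n}"
  shows "block_number Q k = block_number P k"
proof -
  obtain B where B: "B \<in> P" "k \<in> B"
    using partitions_Union[OF P] k by blast
  let ?r = "\<lambda>B. B \<inter> {1..m}"
  have B': "?r B \<in> Q" "k \<in> ?r B"
    using B k unfolding eq by blast+
  have sub: "A \<subseteq> {1..n}" if "A \<in> P" for A
    using partitions_Union[OF P] that by auto
  have Min_r: "Min (?r A) = Min A" if "A \<in> P" "?r A \<noteq> {}" for A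
    using that partitions_block_finite[OF P] sub by (intro Min_Int_atLeastAtMost[of _ n]) auto
  have MinB: "Min (?r B) = Min B"
    using B B' by (intro Min_r) auto
  have "Min B \<le> m"
    using Min_le[OF partitions_block_finite[OF P B(1)] B(2)] k by auto
  \<comment> \<open>A block that starts no later than \<open>B\<close> starts inside
    \<open>{1..m}\<close>, so its trace is not lost.\<close>
  then have ne: "?r A \<noteq> {}" if "A \<in> P" "Min A \<le> Min B" for A
  proof -
    have "Min A \<in> A" "Min A \<in> {1..n}"
      using partitions_Min_in[OF P that(1)] sub[OF that(1)] by auto
    with \<open>Min B \<le> m\<close> that have "Min A \<in> ?r A" by auto
    then show ?thesis by blast
  qed
  have "bij_betw ?r {A \<in> P. Min A \<le> Min B} {A \<in> Q. Min A \<le> Min (?r B)}"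
    unfolding bij_betw_def
  proof
    show "inj_on ?r {A \<in> P. Min A \<le> Min B}"
    proof (rule inj_onI)
      fix A C assume "A \<in> {A \<in> P. Min A \<le> Min B}" "C \<in> {A \<in> P. Min A \<le> Min B}" "?r A = ?r C"
      with ne[of A] have "A \<in> P" "C \<in> P" "A \<inter> C \<noteq> {}" by auto
      then show "A = C" by (rule partitions_disjoint[OF P])
    qed
    show "?r ` {A \<in> P. Min A \<le> Min B} = {A \<in> Q. Min A \<le> Min (?r B)}"
      unfolding MinB
    proof (intro equalityI subsetI)
      fix C assume "C \<in> ?r ` {A \<in> P. Min A \<le> Min B}"
      then show "C \<in> {A \<in> Q. Min A \<le> Min B}"
        using ne Min_r eq by auto
    next
      fix C assume C: "C \<in> {A \<in> Q. Min A \<le> Min B}"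
      then obtain A where "A \<in> P" "C = ?r A" "?r A \<noteq> {}"
        using eq by auto
      with C Min_r show "C \<in> ?r ` {A \<in> P. Min A \<le> Min B}"
        by auto
    qed
  qed
  from bij_betw_same_card[OF this] show ?thesis
    by (simp only: block_number_conv_card[OF P B] block_number_conv_card[OF Q B'])
qed

text \<open>\<open>block_index\<close> refers to all levels from \<open>j\<close> on. Consistency
  makes the block number of \<open>j\<close> the same at each of them, so any single level
  containing \<open>j\<close> computes it.\<close>

lemma block_index_eq_block_number:
  assumes P: "\<And>n. P n \<in> partitions n"
    and consistent: "\<And>m n. m \<le> n \<Longrightarrow> P m = (\<lambda>B. B \<inter> {1..m}) ` P n - {{}}"
    and j: "j \<in> {1..n}"
  shows "block_index P j = block_number (P n) j"
proof -
  have const: "block_number (P n) j = block_number (P l) j" if "l \<ge> j" for l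
  proof (cases "n \<le> l")
    case True
    then show ?thesis
      using j that by (intro block_number_restrict[OF P P consistent]) auto
  next
    case False
    then show ?thesis
      using j that by (intro block_number_restrict[OF P P consistent, symmetric]) auto
  qed
  show ?thesis
    unfolding block_index_def
  proof (rule the_equality)
    show "\<forall>l\<ge>j. block_number (P n) j \<in> {1..card (P l)} \<and> j \<in> block (P l) (block_number (P n) j)"
      using const block_number_in[OF P] block_number_block[OF P] j by auto
    fix c assume "\<forall>l\<ge>j. c \<in> {1..card (P l)} \<and> j \<in> block (P l) c"
    then show "c = block_number (P n) j"
      using j block_number_eq[OF P] by (metis atLeastAtMost_iff)
  qed
qed

section \<open>Maps with a given partition into fibres\<close>

text \<open>The kernel of \<open>f\<close> on \<open>{1..m}\<close>. Taking the image of
  \<open>{1..m}\<close> rather than ranging over values of \<open>f\<close> avoids empty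
  fibres.\<close>

definition fibres :: "nat \<Rightarrow> (nat \<Rightarrow> 'a) \<Rightarrow> nat set set" where
  "fibres m f = (\<lambda>k. {l \<in> {1..m}. f l = f k}) ` {1..m}"

text \<open>The map that is constant on each block, with values listed in the order of the blocks;
  list positions start at 0 and block numbers at 1. The restriction places it in the extensional
  function space.\<close>

definition spread :: "nat \<Rightarrow> nat set set \<Rightarrow> 'a list \<Rightarrow> nat \<Rightarrow> 'a" where
  "spread m P xs = (\<lambda>k\<in>{1..m}. xs ! (block_number P k - 1))"

lemma fibres_in_partitions: "fibres m f \<in> partitions m"
  by (auto simp: fibres_def partitions_def partition_on_def disjoint_def)

lemma blocks_nth_in: "P \<in> partitions n \<Longrightarrow> c < card P \<Longrightarrow> blocks P ! c \<in> P"
  using set_blocks length_blocks by (metis nth_mem)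

lemma blocks_nth_eq_block: "blocks P ! c = block P (Suc c)"
  by (simp add: block_def)

lemma spread_block:
  assumes "P \<in> partitions m" "c < card P" "k \<in> blocks P ! c"
  shows "spread m P xs k = xs ! c"
  using in_block_iff[OF assms(1), of "Suc c" k] assms by (simp add: spread_def blocks_nth_eq_block)

text \<open>As \<open>xs\<close> has no repetitions, two points get the same value exactly when they
  have the same block number.\<close>

lemma fibres_spread:
  assumes P: "P \<in> partitions m" and xs: "distinct xs" "length xs = card P"
  shows "fibres m (spread m P xs) = P"
proof -
  have fibre: "{l \<in> {1..m}. spread m P xs l = spread m P xs k} = block P (block_number P k)"
    if k: "k \<in> {1..m}" for k
  proof -
    have "spread m P xs l = spread m P xs k \<longleftrightarrow> block_number P l = block_number P k"
      if l: "l \<in> {1..m}" for l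
      using block_number_in[OF P k] block_number_in[OF P l] k l xs
      by (auto simp: spread_def nth_eq_iff_index_eq)
    then show ?thesis
      using in_block_iff[OF P block_number_in[OF P k]] by blast
  qed
  have "fibres m (spread m P xs) = block P ` block_number P ` {1..m}"
    unfolding fibres_def image_image by (rule image_cong[OF refl fibre])
  also have "block_number P ` {1..m} = {1..card P}"
  proof
    show "block_number P ` {1..m} \<subseteq> {1..card P}"
      using block_number_in[OF P] by auto
    show "{1..card P} \<subseteq> block_number P ` {1..m}"
    proof
      fix c assume c: "c \<in> {1..card P}"
      then obtain k where "k \<in> block P c"
        using partitions_block_nonempty[OF P block_in[OF P c]] by blast
      then show "c \<in> block_number P ` {1..m}"
        using in_block_iff[OF P c, of k] by (metis imageI)
    qed
  qed
  also have "block P ` {1..card P} = P"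
    by (rule bij_betw_imp_surj_on[OF bij_betw_block[OF P]])
  finally show ?thesis .
qed

text \<open>A map with fibre partition \<open>P\<close> amounts to one value for each block,
  different for different blocks. This is what turns a sum over maps into sums over tuples of
  distinct atoms.\<close>

lemma bij_betw_spread:
  assumes P: "P \<in> partitions m"
  shows "bij_betw (spread m P :: 'a list \<Rightarrow> nat \<Rightarrow> 'a) {xs. length xs = card P \<and> distinct xs}
    {f \<in> {1..m} \<rightarrow>\<^sub>E UNIV. fibres m f = P}"
  unfolding bij_betw_def
proof
  show "inj_on (spread m P :: 'a list \<Rightarrow> nat \<Rightarrow> 'a) {xs. length xs = card P \<and> distinct xs}"
  proof (rule inj_onI)
    fix xs ys :: "'a list"
    assume eq: "spread m P xs = spread m P ys"
      and xs: "xs \<in> {xs. length xs = card P \<and> distinct xs}"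
      and ys: "ys \<in> {xs. length xs = card P \<and> distinct xs}"
    show "xs = ys"
    proof (rule nth_equalityI)
      fix c assume "c < length xs"
      then have c: "c < card P" using xs by simp
      then obtain k where k: "k \<in> blocks P ! c"
        using partitions_block_nonempty[OF P blocks_nth_in[OF P c]] by blast
      then show "xs ! c = ys ! c"
        using spread_block[OF P c k] eq by metis
    qed (use xs ys in simp)
  qed
  show "(spread m P :: 'a list \<Rightarrow> nat \<Rightarrow> 'a) ` {xs. length xs = card P \<and> distinct xs} =
      {f \<in> {1..m} \<rightarrow>\<^sub>E UNIV. fibres m f = P}" (is "?L = ?R")
  proof (intro equalityI subsetI)
    fix f assume "f \<in> ?L"
    then show "f \<in> ?R"
      using fibres_spread[OF P] by (auto simp: spread_def)
  next
    fix f :: "nat \<Rightarrow> 'a" assume "f \<in> ?R"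
    then have f: "f \<in> extensional {1..m}" and ker: "fibres m f = P"
      by (auto simp: PiE_def)
    have const: "f k = f l" if "B \<in> P" "k \<in> B" "l \<in> B" for B k l
      using that unfolding ker[symmetric] fibres_def by auto
    have sep: "k \<in> B \<longleftrightarrow> f k = f l" if "B \<in> P" "l \<in> B" "k \<in> {1..m}" for B k l
      using that unfolding ker[symmetric] fibres_def by auto
    \<comment> \<open>The preimage of \<open>f\<close> lists its values at the minima of the blocks;
      since \<open>f\<close> is constant on blocks, the minimum is just a convenient
      representative.\<close>
    define xs where "xs = map (\<lambda>B. f (Min B)) (blocks P)"
    have "inj_on (\<lambda>B. f (Min B)) P"
    proof (rule inj_onI)
      fix B C assume *: "B \<in> P" "C \<in> P" "f (Min B) = f (Min C)"
      have "Min B \<in> {1..m}"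
        using partitions_Min_in[OF P *(1)] partitions_Union[OF P] *(1) by blast
      then have "Min B \<in> C"
        using sep[OF *(2) partitions_Min_in[OF P *(2)]] *(3) by blast
      then show "B = C"
        using partitions_disjoint[OF P *(1,2)] partitions_Min_in[OF P *(1)] by blast
    qed
    then have "distinct xs"
      unfolding xs_def distinct_map using distinct_blocks[OF P] set_blocks[OF P] by simp
    moreover have "length xs = card P"
      by (simp add: xs_def length_blocks[OF P])
    moreover have "spread m P xs = f"
    proof (rule extensionalityI[OF _ f])
      show "spread m P xs \<in> extensional {1..m}"
        by (simp add: spread_def)
      fix k assume k: "k \<in> {1..m}"
      let ?B = "block P (block_number P k)"
      have B: "?B \<in> P" "k \<in> ?B"
        using block_in[OF P block_number_in[OF P k]] block_number_block[OF P k] by auto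
      have "block_number P k - 1 < card P"
        using block_number_in[OF P k] by auto
      then have "spread m P xs k = f (Min ?B)"
        using k by (simp add: spread_def xs_def length_blocks[OF P] block_def)
      also have "\<dots> = f k"
        by (rule const[OF B(1) partitions_Min_in[OF P B(1)] B(2)])
      finally show "spread m P xs k = f k" .
    qed
    ultimately show "f \<in> ?L" by blast
  qed
qed

lemma prod_blocks:
  fixes g :: "nat \<Rightarrow> 'a::comm_monoid_mult"
  assumes P: "P \<in> partitions m"
  shows "(\<Prod>k\<in>{1..m}. g k) = (\<Prod>c<card P. \<Prod>k\<in>blocks P ! c. g k)"
proof -
  have "(\<Prod>k\<in>{1..m}. g k) = (\<Prod>B\<in>P. \<Prod>k\<in>B. g k)"
    unfolding partitions_Union[OF P, symmetric]
    using partitions_block_finite[OF P] partitions_disjoint[OF P]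
    by (subst prod.Union_disjoint) (auto simp: comp_def)
  also have "\<dots> = (\<Prod>c<card P. \<Prod>k\<in>blocks P ! c. g k)"
    using bij_betw_nth[OF distinct_blocks[OF P]]
    by (intro prod.reindex_bij_betw[symmetric]) (simp add: length_blocks[OF P] set_blocks[OF P])
  finally show ?thesis .
qed

text \<open>With series read as integrals for counting measure, Tonelli turns the product into one
  sum over all maps from \<open>{1..m}\<close> to \<open>nat\<close>. Values in
  \<open>ennreal\<close> remove all convergence questions.\<close>

lemma prod_suminf_conv_fibres:
  fixes g :: "nat \<Rightarrow> nat \<Rightarrow> ennreal"
  shows "(\<Prod>k\<in>{1..m}. \<Sum>j. g k j) =
    (\<Sum>P\<in>partitions m. \<integral>\<^sup>+xs. (\<Prod>c<card P. \<Prod>k\<in>blocks P ! c. g k (xs ! c))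
       \<partial>count_space {xs. length xs = card P \<and> distinct xs})"
proof -
  interpret product_sigma_finite "\<lambda>_. count_space (UNIV :: nat set)"
    by (simp add: product_sigma_finite_def sigma_finite_measure_count_space)
  let ?E = "{1..m} \<rightarrow>\<^sub>E (UNIV :: nat set)"
  let ?G = "\<lambda>f. \<Prod>k\<in>{1..m}. g k (f k)"
  have "(\<Prod>k\<in>{1..m}. \<Sum>j. g k j) = (\<Prod>k\<in>{1..m}. \<integral>\<^sup>+j. g k j \<partial>count_space UNIV)"
    by (simp add: nn_integral_count_space_nat)
  also have "\<dots> = (\<integral>\<^sup>+f. ?G f \<partial>PiM {1..m} (\<lambda>_. count_space UNIV))"
    by (rule product_nn_integral_prod[symmetric]) auto
  also have "\<dots> = (\<integral>\<^sup>+f. ?G f \<partial>count_space ?E)"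
    by (subst count_space_PiM_finite) auto
  \<comment> \<open>For each \<open>f\<close> only the summand \<open>P = fibres m f\<close>
    survives.\<close>
  also have "\<dots> = (\<integral>\<^sup>+f. (\<Sum>P\<in>partitions m. ?G f * indicator {f. fibres m f = P} f) \<partial>count_space ?E)"
  proof (rule nn_integral_cong)
    fix f :: "nat \<Rightarrow> nat"
    have "(\<Sum>P\<in>partitions m. ?G f * indicator {f. fibres m f = P} f) =
        (\<Sum>P\<in>partitions m. if P = fibres m f then ?G f else 0)"
      by (intro sum.cong) (auto simp: indicator_def)
    then show "?G f = (\<Sum>P\<in>partitions m. ?G f * indicator {f. fibres m f = P} f)"
      by (simp add: finite_partitions fibres_in_partitions)
  qed
  also have "\<dots> = (\<Sum>P\<in>partitions m. \<integral>\<^sup>+f. ?G f * indicator {f. fibres m f = P} f \<partial>count_space ?E)"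
    by (intro nn_integral_sum) auto
  also have "\<dots> = (\<Sum>P\<in>partitions m. \<integral>\<^sup>+xs. (\<Prod>c<card P. \<Prod>k\<in>blocks P ! c. g k (xs ! c))
       \<partial>count_space {xs. length xs = card P \<and> distinct xs})"
  proof (rule sum.cong[OF refl])
    fix P assume P: "P \<in> partitions m"
    have "(\<integral>\<^sup>+f. ?G f * indicator {f. fibres m f = P} f \<partial>count_space ?E) =
        (\<integral>\<^sup>+f. ?G f * indicator {f. fibres m f = P} f \<partial>count_space {f \<in> ?E. fibres m f = P})"
      by (rule nn_integral_count_space_eq) auto
    also have "\<dots> = (\<integral>\<^sup>+f. ?G f \<partial>count_space {f \<in> ?E. fibres m f = P})"
      by (rule nn_integral_cong) simp
    also have "\<dots> = (\<integral>\<^sup>+xs. ?G (spread m P xs) \<partial>count_space {xs. length xs = card P \<and> distinct xs})"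
      by (rule nn_integral_bij_count_space[OF bij_betw_spread[OF P], symmetric])
    also have "\<dots> = (\<integral>\<^sup>+xs. (\<Prod>c<card P. \<Prod>k\<in>blocks P ! c. g k (xs ! c))
       \<partial>count_space {xs. length xs = card P \<and> distinct xs})"
      unfolding prod_blocks[OF P] by (simp add: spread_block[OF P])
    finally show "(\<integral>\<^sup>+f. ?G f * indicator {f. fibres m f = P} f \<partial>count_space ?E) = \<dots>" .
  qed
  finally show ?thesis .
qed

section \<open>Mixed moments of a species sampling random probability\<close>

lemma prod_indicator_eq_indicator_INT:
  assumes "finite A"
  shows "(\<Prod>k\<in>A. indicator (B k) x) = (indicator (\<Inter>k\<in>A. B k) x :: 'b::{comm_semiring_1})"
  using assms by (induction A rule: finite_induct) (auto simp: indicator_def)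

text \<open>\<open>X\<close> and \<open>Y\<close> may have different value types, so independence is
  given on generated events. After composition with \<open>f\<close> and \<open>g\<close> both
  variables are \<open>ennreal\<close>-valued and the product formula for independent variables
  applies.\<close>

lemma (in prob_space) indep_set_nn_integral_mult:
  assumes X: "X \<in> measurable M S" and Y: "Y \<in> measurable M T"
    and indep: "indep_set (gen_events M S X) (gen_events M T Y)"
    and f: "f \<in> borel_measurable S" and g: "g \<in> borel_measurable T"
  shows "(\<integral>\<^sup>+\<omega>. f (X \<omega>) * g (Y \<omega>) \<partial>M) = (\<integral>\<^sup>+\<omega>. f (X \<omega>) \<partial>M) * (\<integral>\<^sup>+\<omega>. g (Y \<omega>) \<partial>M)"
proof -
  let ?V = "case_bool (f \<circ> X) (g \<circ> Y)"
  \<comment> \<open>Composition with a Borel function can only shrink the generated family of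
    events.\<close>
  have sub: "sigma_sets (space M) {(h \<circ> U) -` A \<inter> space M | A. A \<in> sets borel} \<subseteq> gen_events M R U"
    if U: "U \<in> measurable M R" and h: "h \<in> borel_measurable R" for U R and h :: "_ \<Rightarrow> ennreal"
  proof -
    have "h \<circ> U \<in> borel_measurable (vimage_algebra (space M) U R)"
      by (rule measurable_comp[OF measurable_vimage_algebra1 h]) (use measurable_space[OF U] in blast)
    from measurable_sets[OF this] have "(h \<circ> U) -` A \<inter> space M \<in> sets (vimage_algebra (space M) U R)"
      if "A \<in> sets borel" for A
      using that by simp
    then show ?thesis
      unfolding gen_events_def
      using sets.sigma_sets_subset[of "{(h \<circ> U) -` A \<inter> space M | A. A \<in> sets borel}"
          "vimage_algebra (space M) U R"] by auto
  qed
  have "indep_set (sigma_sets (space M) {(f \<circ> X) -` A \<inter> space M | A. A \<in> sets borel})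
      (sigma_sets (space M) {(g \<circ> Y) -` A \<inter> space M | A. A \<in> sets borel})"
    using indep sub[OF X f] sub[OF Y g] unfolding indep_sets2_eq by blast
  then have "indep_var borel (f \<circ> X) borel (g \<circ> Y)"
    using measurable_comp[OF X f] measurable_comp[OF Y g] by (simp add: indep_var_eq)
  moreover have "case_bool borel borel = (\<lambda>_. borel :: ennreal measure)"
    by (auto split: bool.split)
  ultimately have "indep_vars (\<lambda>_. borel) ?V UNIV"
    by (simp add: indep_var_def)
  then have "(\<integral>\<^sup>+\<omega>. (\<Prod>b\<in>UNIV. ?V b \<omega>) \<partial>M) = (\<Prod>b\<in>UNIV. \<integral>\<^sup>+\<omega>. ?V b \<omega> \<partial>M)"
    by (intro indep_vars_nn_integral) auto
  then show ?thesis
    by (simp add: UNIV_bool mult.commute comp_def)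
qed

text \<open>Distinct entries of \<open>xs\<close> pick different variables of the i.i.d. sequence,
  so the expectation of the product factors.\<close>

lemma (in prob_space) nn_integral_prod_indicator_iid:
  fixes Z :: "nat \<Rightarrow> 'a \<Rightarrow> 'x::topological_space"
  assumes indep: "indep_vars (\<lambda>_. borel) Z UNIV" and distr: "\<And>j. distr M borel (Z j) = H"
    and xs: "distinct xs" and B: "\<And>c. c < length xs \<Longrightarrow> B c \<in> sets borel"
  shows "(\<integral>\<^sup>+\<omega>. (\<Prod>c<length xs. indicator (B c) (Z (xs ! c) \<omega>)) \<partial>M) =
    (\<Prod>c<length xs. emeasure H (B c))"
proof -
  \<comment> \<open>\<open>?g\<close> recovers the position of an atom in \<open>xs\<close>. It
    converts sets indexed by positions into sets indexed by atoms, the index of the independent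
    family \<open>Z\<close>.\<close>
  let ?g = "inv_into {..<length xs} ((!) xs)"
  have bij: "bij_betw ((!) xs) {..<length xs} (set xs)"
    by (rule bij_betw_nth[OF xs refl refl])
  have g: "?g (xs ! c) = c" if "c < length xs" for c
    using bij_betw_inv_into_left[OF bij] that by simp
  have B': "B (?g j) \<in> sets borel" if "j \<in> set xs" for j
    using that g B by (auto simp: in_set_conv_nth)
  have Z: "Z j \<in> borel_measurable M" for j
    using indep by (auto simp: indep_vars_def)
  have "indep_vars (\<lambda>_. borel) Z (set xs)"
    using indep by (rule indep_vars_subset) simp
  then have indep': "indep_vars (\<lambda>_. borel) (\<lambda>j \<omega>. indicator (B (?g j)) (Z j \<omega>) :: ennreal) (set xs)"
    by (rule indep_vars_compose2) (use B' in simp)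
  have "(\<integral>\<^sup>+\<omega>. (\<Prod>c<length xs. indicator (B c) (Z (xs ! c) \<omega>)) \<partial>M) =
      (\<integral>\<^sup>+\<omega>. (\<Prod>c<length xs. indicator (B (?g (xs ! c))) (Z (xs ! c) \<omega>)) \<partial>M)"
    by (simp add: g)
  also have "\<dots> = (\<integral>\<^sup>+\<omega>. (\<Prod>j\<in>set xs. indicator (B (?g j)) (Z j \<omega>)) \<partial>M)"
    by (subst prod.reindex_bij_betw[OF bij]) simp
  also have "\<dots> = (\<Prod>j\<in>set xs. \<integral>\<^sup>+\<omega>. indicator (B (?g j)) (Z j \<omega>) \<partial>M)"
    by (rule indep_vars_nn_integral[OF _ indep']) auto
  also have "\<dots> = (\<Prod>j\<in>set xs. emeasure H (B (?g j)))"
  proof (rule prod.cong[OF refl])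
    fix j assume j: "j \<in> set xs"
    have "(\<integral>\<^sup>+\<omega>. indicator (B (?g j)) (Z j \<omega>) \<partial>M) =
        (\<integral>\<^sup>+z. indicator (B (?g j)) z \<partial>distr M borel (Z j))"
      using B'[OF j] Z by (intro nn_integral_distr[symmetric]) auto
    also have "\<dots> = emeasure (distr M borel (Z j)) (B (?g j))"
      using B'[OF j] by simp
    finally show "(\<integral>\<^sup>+\<omega>. indicator (B (?g j)) (Z j \<omega>) \<partial>M) = emeasure H (B (?g j))"
      by (simp add: distr)
  qed
  also have "\<dots> = (\<Prod>c<length xs. emeasure H (B (?g (xs ! c))))"
    by (rule prod.reindex_bij_betw[OF bij, symmetric])
  also have "\<dots> = (\<Prod>c<length xs. emeasure H (B c))"
    by (simp add: g)
  finally show ?thesis .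
qed

text \<open>Countability of \<open>A\<close> gives joint measurability in \<open>x\<close> and
  \<open>i\<close> and makes the counting measure sigma-finite; the partial integral is then
  measurable.\<close>

lemma borel_measurable_nn_integral_count_space:
  assumes A: "countable A" and f: "\<And>i. i \<in> A \<Longrightarrow> f i \<in> borel_measurable M"
  shows "(\<lambda>x. \<integral>\<^sup>+i. f i x \<partial>count_space A) \<in> borel_measurable M"
proof -
  have "(\<lambda>p. f (snd p) (fst p)) \<in> borel_measurable (M \<Otimes>\<^sub>M count_space A)"
    using A f by (intro measurable_compose_countable'[where f = "\<lambda>i p. f i (fst p)" and g = snd and I = A])
      (auto intro: measurable_compose[OF measurable_fst])
  then show ?thesis
    using sigma_finite_measure.borel_measurable_nn_integral[OF sigma_finite_measure_count_space_countable[OF A],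
        of "\<lambda>x i. f i x" M] by (simp add: case_prod_beta')
qed

text \<open>Connects the real sum by which \<open>SSrp\<close> describes \<open>q0\<close> with the
  extended integrals used in the expansion. A finite total makes every term finite, so
  \<open>enn2real\<close> loses nothing.\<close>

lemma infsum_enn2real_conv_nn_integral:
  fixes f :: "'a \<Rightarrow> ennreal"
  assumes "(\<integral>\<^sup>+x. f x \<partial>count_space A) < \<infinity>"
  shows "(\<Sum>\<^sub>\<infinity>x\<in>A. enn2real (f x)) = enn2real (\<integral>\<^sup>+x. f x \<partial>count_space A)"
proof -
  have fin: "f x \<noteq> \<infinity>" if "x \<in> A" for x
    using nn_integral_noteq_infinite[of f "count_space A"] assms that
    by (auto simp: AE_count_space)
  have eq: "(\<integral>\<^sup>+x. ennreal (enn2real (f x)) \<partial>count_space A) = (\<integral>\<^sup>+x. f x \<partial>count_space A)"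
    using fin by (intro nn_integral_cong) (simp add: ennreal_enn2real_if)
  have "integrable (count_space A) (\<lambda>x. enn2real (f x))"
    using assms eq by (intro integrableI_nonneg) auto
  then have "(\<Sum>\<^sub>\<infinity>x\<in>A. enn2real (f x)) = infsetsum (\<lambda>x. enn2real (f x)) A"
    by (intro infsetsum_infsum[symmetric]) (simp add: Infinite_Set_Sum.abs_summable_on_def)
  also have "\<dots> = enn2real (\<integral>\<^sup>+x. ennreal (enn2real (f x)) \<partial>count_space A)"
    unfolding infsetsum_def by (intro integral_eq_nn_integral) auto
  finally show ?thesis
    by (simp add: eq)
qed

section \<open>Expansion of moments over weights and atoms\<close>

context
  fixes N :: "'b measure" and w :: "nat \<Rightarrow> 'b \<Rightarrow> real" and Z :: "nat \<Rightarrow> 'b \<Rightarrow> 'x::topological_space"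
    and H0 :: "'x measure"
  assumes prob_N: "prob_space N" and prob_H0: "prob_space H0"
    and w_meas: "\<And>j. w j \<in> borel_measurable N"
    and w_nonneg: "\<And>j. \<forall>\<omega>\<in>space N. 0 \<le> w j \<omega>"
    and w_sums: "AE \<omega> in N. (\<lambda>j. w j \<omega>) sums 1"
    and Z_indep: "prob_space.indep_vars N (\<lambda>_. borel) Z UNIV"
    and Z_distr: "\<And>j. distr N borel (Z j) = H0"
    and wZ_indep: "prob_space.indep_set N
          (gen_events N (\<Pi>\<^sub>M j\<in>UNIV. borel) (\<lambda>\<omega> j. w j \<omega>))
          (gen_events N (\<Pi>\<^sub>M j\<in>UNIV. borel) (\<lambda>\<omega> j. Z j \<omega>))"
begin

interpretation N: prob_space N by (rule prob_N)

lemma Z_meas: "Z j \<in> borel_measurable N"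
  using Z_indep by (auto simp: N.indep_vars_def)

text \<open>One summand of the species sampling formula for an EPPF, with values in
  \<open>ennreal\<close> so that it can be summed and exchanged with integrals freely.\<close>

definition weight_moment :: "nat list \<Rightarrow> nat list \<Rightarrow> ennreal" where
  "weight_moment ns xs = (\<integral>\<^sup>+\<omega>. (\<Prod>c<length ns. ennreal (w (xs ! c) \<omega>) ^ (ns ! c)) \<partial>N)"

text \<open>Weights and atoms are independent, so the expectation splits. The weights leave a moment
  with the block sizes as exponents; the atoms chosen for different blocks are i.i.d. and contribute
  one factor for each block.\<close>

lemma nn_integral_weights_atoms:
  assumes P: "P \<in> partitions m" and D: "\<And>k. k \<in> {1..m} \<Longrightarrow> D k \<in> sets borel"
    and xs: "distinct xs" "length xs = card P"
  shows "(\<integral>\<^sup>+\<omega>. (\<Prod>c<card P. \<Prod>k\<in>blocks P ! c. ennreal (w (xs ! c) \<omega>) * indicator (D k) (Z (xs ! c) \<omega>)) \<partial>N)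
    = weight_moment (block_sizes P) xs * (\<Prod>B\<in>P. emeasure H0 (\<Inter>k\<in>B. D k))"
proof -
  let ?ns = "block_sizes P"
  let ?B = "\<lambda>c. \<Inter>k\<in>blocks P ! c. D k"
  let ?f = "\<lambda>v. \<Prod>c<card P. ennreal (v (xs ! c)) ^ (?ns ! c)"
  let ?g = "\<lambda>z. \<Prod>c<card P. indicator (?B c) (z (xs ! c)) :: ennreal"
  have B: "?B c \<in> sets borel" if "c < card P" for c
  proof -
    have "blocks P ! c \<in> P" using blocks_nth_in[OF P that] .
    then have "blocks P ! c \<noteq> {}" "finite (blocks P ! c)" "blocks P ! c \<subseteq> {1..m}"
      using partitions_block_nonempty[OF P] partitions_block_finite[OF P] partitions_Union[OF P] by auto
    then show ?thesis
      using D by (intro sets.finite_INT) auto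
  qed
  \<comment> \<open>Within a block the weight is the same for all \<open>k\<close>, which gives a
    power, and the indicators are evaluated at the same atom, which gives an intersection.\<close>
  have "(\<Prod>c<card P. \<Prod>k\<in>blocks P ! c. ennreal (w (xs ! c) \<omega>) * indicator (D k) (Z (xs ! c) \<omega>))
      = ?f (\<lambda>j. w j \<omega>) * ?g (\<lambda>j. Z j \<omega>)" for \<omega>
    using blocks_nth_in[OF P] partitions_block_finite[OF P]
    unfolding prod.distrib
    by (intro arg_cong2[where f = "(*)"] prod.cong)
      (auto simp: block_sizes_def length_blocks[OF P] prod_indicator_eq_indicator_INT)
  then have "(\<integral>\<^sup>+\<omega>. (\<Prod>c<card P. \<Prod>k\<in>blocks P ! c. ennreal (w (xs ! c) \<omega>) * indicator (D k) (Z (xs ! c) \<omega>)) \<partial>N)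
      = (\<integral>\<^sup>+\<omega>. ?f (\<lambda>j. w j \<omega>) * ?g (\<lambda>j. Z j \<omega>) \<partial>N)"
    by simp
  also have "\<dots> = (\<integral>\<^sup>+\<omega>. ?f (\<lambda>j. w j \<omega>) \<partial>N) * (\<integral>\<^sup>+\<omega>. ?g (\<lambda>j. Z j \<omega>) \<partial>N)"
  proof (rule N.indep_set_nn_integral_mult[OF _ _ wZ_indep])
    show "(\<lambda>\<omega> j. w j \<omega>) \<in> measurable N (\<Pi>\<^sub>M j\<in>UNIV. borel)"
      using w_meas by (intro measurable_PiM_single') (auto simp: space_PiM)
    show "(\<lambda>\<omega> j. Z j \<omega>) \<in> measurable N (\<Pi>\<^sub>M j\<in>UNIV. borel)"
      using Z_meas by (intro measurable_PiM_single') (auto simp: space_PiM)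
    show "?f \<in> borel_measurable (\<Pi>\<^sub>M j\<in>UNIV. borel)"
      by measurable
    show "?g \<in> borel_measurable (\<Pi>\<^sub>M j\<in>UNIV. borel)"
    proof (rule borel_measurable_prod_ennreal)
      fix c assume "c \<in> {..<card P}"
      then show "(\<lambda>z. indicator (?B c) (z (xs ! c))) \<in> borel_measurable (\<Pi>\<^sub>M j\<in>UNIV. borel)"
        by (intro measurable_compose[OF measurable_component_singleton] borel_measurable_indicator B) auto
    qed
  qed
  also have "(\<integral>\<^sup>+\<omega>. ?g (\<lambda>j. Z j \<omega>) \<partial>N) = (\<Prod>c<card P. emeasure H0 (?B c))"
    using N.nn_integral_prod_indicator_iid[OF Z_indep Z_distr xs(1), of ?B] B xs by simp
  also have "\<dots> = (\<Prod>B\<in>P. emeasure H0 (\<Inter>k\<in>B. D k))"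
    using bij_betw_nth[OF distinct_blocks[OF P]]
    by (intro prod.reindex_bij_betw) (simp add: length_blocks[OF P] set_blocks[OF P])
  also have "(\<integral>\<^sup>+\<omega>. ?f (\<lambda>j. w j \<omega>) \<partial>N) = weight_moment ?ns xs"
    by (simp add: weight_moment_def block_sizes_def length_blocks[OF P])
  finally show ?thesis .
qed

text \<open>The expansion over fibre partitions is taken under the expectation. All terms are
  nonnegative and the sums are countable, so sums and integrals may be exchanged before each term is
  factored.\<close>

lemma nn_integral_prod_suminf:
  assumes D: "\<And>k. k \<in> {1..m} \<Longrightarrow> D k \<in> sets borel"
  shows "(\<integral>\<^sup>+\<omega>. (\<Prod>k\<in>{1..m}. \<Sum>j. ennreal (w j \<omega>) * indicator (D k) (Z j \<omega>)) \<partial>N) =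
    (\<Sum>P\<in>partitions m. (\<integral>\<^sup>+xs. weight_moment (block_sizes P) xs
       \<partial>count_space {xs. length xs = card P \<and> distinct xs}) * (\<Prod>B\<in>P. emeasure H0 (\<Inter>k\<in>B. D k)))"
proof -
  let ?S = "\<lambda>P. count_space {xs :: nat list. length xs = card P \<and> distinct xs}"
  let ?T = "\<lambda>P xs \<omega>. \<Prod>c<card P. \<Prod>k\<in>blocks P ! c. ennreal (w (xs ! c) \<omega>) * indicator (D k) (Z (xs ! c) \<omega>)"
  have sub: "blocks P ! c \<subseteq> {1..m}" if "P \<in> partitions m" "c < card P" for P c
    using partitions_Union[OF that(1)] blocks_nth_in[OF that] by auto
  have meas: "?T P xs \<in> borel_measurable N" if "P \<in> partitions m" for P xs
  proof (rule borel_measurable_prod_ennreal, rule borel_measurable_prod_ennreal)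
    fix c k assume "c \<in> {..<card P}" "k \<in> blocks P ! c"
    then have "D k \<in> sets borel"
      using sub[OF that] by (intro D) blast
    then show "(\<lambda>\<omega>. ennreal (w (xs ! c) \<omega>) * indicator (D k) (Z (xs ! c) \<omega>)) \<in> borel_measurable N"
      by (intro borel_measurable_times_ennreal measurable_compose[OF Z_meas]
          borel_measurable_indicator measurable_compose[OF w_meas] measurable_ennreal) auto
  qed
  have "(\<integral>\<^sup>+\<omega>. (\<Prod>k\<in>{1..m}. \<Sum>j. ennreal (w j \<omega>) * indicator (D k) (Z j \<omega>)) \<partial>N) =
      (\<integral>\<^sup>+\<omega>. (\<Sum>P\<in>partitions m. \<integral>\<^sup>+xs. ?T P xs \<omega> \<partial>?S P) \<partial>N)"
    by (simp only: prod_suminf_conv_fibres)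
  also have "\<dots> = (\<Sum>P\<in>partitions m. \<integral>\<^sup>+\<omega>. (\<integral>\<^sup>+xs. ?T P xs \<omega> \<partial>?S P) \<partial>N)"
    using meas by (intro nn_integral_sum borel_measurable_nn_integral_count_space) auto
  also have "\<dots> = (\<Sum>P\<in>partitions m. \<integral>\<^sup>+xs. (\<integral>\<^sup>+\<omega>. ?T P xs \<omega> \<partial>N) \<partial>?S P)"
    using meas by (intro sum.cong nn_integral_count_space_nn_integral) auto
  also have "\<dots> = (\<Sum>P\<in>partitions m. \<integral>\<^sup>+xs. weight_moment (block_sizes P) xs *
      (\<Prod>B\<in>P. emeasure H0 (\<Inter>k\<in>B. D k)) \<partial>?S P)"
    using D by (intro sum.cong nn_integral_cong nn_integral_weights_atoms) auto
  also have "\<dots> = (\<Sum>P\<in>partitions m. (\<integral>\<^sup>+xs. weight_moment (block_sizes P) xs \<partial>?S P) *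
      (\<Prod>B\<in>P. emeasure H0 (\<Inter>k\<in>B. D k)))"
    by (intro sum.cong nn_integral_multc) auto
  finally show ?thesis .
qed

lemma suminf_weights_eq_1: "AE \<omega> in N. (\<Sum>j. ennreal (w j \<omega>)) = 1"
  using w_sums AE_space
proof eventually_elim
  case (elim \<omega>)
  then have "(\<lambda>j. ennreal (w j \<omega>)) sums ennreal 1"
    by (subst sums_ennreal) (auto simp: w_nonneg)
  then show ?case
    using sums_unique by fastforce
qed

text \<open>The case where every \<open>D k\<close> is the whole space: each series is then the
  total weight, almost surely 1. The result supplies finiteness of the single summands.\<close>

lemma sum_nn_integral_weight_moment:
  "(\<Sum>P\<in>partitions m. \<integral>\<^sup>+xs. weight_moment (block_sizes P) xs
     \<partial>count_space {xs. length xs = card P \<and> distinct xs}) = 1"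
proof -
  \<comment> \<open>\<open>H0\<close> is the law of an atom on \<open>borel\<close>, hence its space
    is \<open>UNIV\<close>.\<close>
  have "emeasure H0 UNIV = 1"
    using prob_space.emeasure_space_1[OF prob_H0] Z_distr[of 0] by (metis space_borel space_distr)
  moreover have "(\<Inter>k\<in>B. UNIV) = UNIV" for B :: "nat set" by simp
  ultimately have "(\<Sum>P\<in>partitions m. \<integral>\<^sup>+xs. weight_moment (block_sizes P) xs
     \<partial>count_space {xs. length xs = card P \<and> distinct xs}) =
      (\<integral>\<^sup>+\<omega>. (\<Prod>k\<in>{1..m}. \<Sum>j. ennreal (w j \<omega>)) \<partial>N)"
    using nn_integral_prod_suminf[of m "\<lambda>_. UNIV"] by simp
  also have "\<dots> = (\<integral>\<^sup>+\<omega>. 1 \<partial>N)"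
  proof (rule nn_integral_cong_AE)
    show "AE \<omega> in N. (\<Prod>k\<in>{1..m}. \<Sum>j. ennreal (w j \<omega>)) = 1"
      using suminf_weights_eq_1 by eventually_elim simp
  qed
  finally show ?thesis
    by (simp add: N.emeasure_space_1)
qed

text \<open>The right-hand side is one term of a nonnegative sum equal to 1, hence finite, so it can
  be read as the real sum on the left.\<close>

lemma infsum_weight_moment:
  assumes P: "P \<in> partitions m"
  shows "ennreal (\<Sum>\<^sub>\<infinity>xs\<in>{xs. length xs = card P \<and> distinct xs}.
      \<integral>\<omega>. (\<Prod>c<card P. w (xs ! c) \<omega> ^ (block_sizes P ! c)) \<partial>N) =
    (\<integral>\<^sup>+xs. weight_moment (block_sizes P) xs \<partial>count_space {xs. length xs = card P \<and> distinct xs})"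
proof -
  let ?I = "\<lambda>P. \<integral>\<^sup>+xs. weight_moment (block_sizes P) xs
    \<partial>count_space {xs. length xs = card P \<and> distinct xs}"
  have "?I P \<le> (\<Sum>P\<in>partitions m. ?I P)"
    using P by (intro member_le_sum) (auto simp: finite_partitions)
  then have fin: "?I P < \<infinity>"
    by (simp only: sum_nn_integral_weight_moment) (simp add: order_le_less_trans[OF _ ennreal_one_less_top])
  have "(\<integral>\<omega>. (\<Prod>c<card P. w (xs ! c) \<omega> ^ (block_sizes P ! c)) \<partial>N) =
      enn2real (weight_moment (block_sizes P) xs)" for xs
  proof -
    have "(\<integral>\<omega>. (\<Prod>c<card P. w (xs ! c) \<omega> ^ (block_sizes P ! c)) \<partial>N) =
        enn2real (\<integral>\<^sup>+\<omega>. ennreal (\<Prod>c<card P. w (xs ! c) \<omega> ^ (block_sizes P ! c)) \<partial>N)"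
      using w_meas w_nonneg
      by (intro integral_eq_nn_integral borel_measurable_prod borel_measurable_power)
        (auto intro!: prod_nonneg)
    also have "(\<integral>\<^sup>+\<omega>. ennreal (\<Prod>c<card P. w (xs ! c) \<omega> ^ (block_sizes P ! c)) \<partial>N) =
        weight_moment (block_sizes P) xs"
      unfolding weight_moment_def using w_nonneg
      by (intro nn_integral_cong)
        (simp add: block_sizes_def length_blocks[OF P] prod_ennreal[symmetric] ennreal_power)
    finally show ?thesis .
  qed
  with infsum_enn2real_conv_nn_integral[OF fin] fin show ?thesis
    by (simp add: ennreal_enn2real_if)
qed

end

section \<open>Moments of the random probability\<close>

lemma SSrp_measurable:
  fixes H0 :: "'x::topological_space measure"
  assumes N: "prob_space N" and SS: "SSrp N p q0 H0" and A: "A \<in> sets borel"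
  shows "(\<lambda>\<omega>. measure (p \<omega>) A) \<in> borel_measurable N"
proof -
  obtain w :: "nat \<Rightarrow> _ \<Rightarrow> real" and Z :: "nat \<Rightarrow> _ \<Rightarrow> 'x" where w: "\<forall>j. w j \<in> borel_measurable N"
    and Z: "prob_space.indep_vars N (\<lambda>_. borel) Z UNIV"
    and p: "\<forall>\<omega>\<in>space N. sets (p \<omega>) = sets borel \<and>
           (\<forall>A\<in>sets borel. emeasure (p \<omega>) A = (\<Sum>j. ennreal (w j \<omega>) * indicator A (Z j \<omega>)))"
    using SS unfolding SSrp_def by (elim exE conjE) (rule that)
  have [measurable]: "w j \<in> borel_measurable N" "Z j \<in> borel_measurable N" for j
    using w Z by (auto simp: prob_space.indep_vars_def[OF N])
  note [measurable] = A
  \<comment> \<open>Evaluation at \<open>A\<close> is the real value of a series built from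
    measurable weights and atoms.\<close>
  have "(\<lambda>\<omega>. enn2real (\<Sum>j. ennreal (w j \<omega>) * indicator A (Z j \<omega>))) \<in> borel_measurable N"
    by measurable
  then show ?thesis
    by (rule measurable_cong[THEN iffD1, rotated]) (simp add: measure_def p A)
qed

text \<open>Needed for padding: a factor for a number that belongs to no cell is the mass of the
  whole space and must equal 1.\<close>

lemma SSrp_AE_measure_UNIV:
  fixes H0 :: "'x::topological_space measure"
  assumes SS: "SSrp N p q0 H0"
  shows "AE \<omega> in N. measure (p \<omega>) UNIV = 1"
proof -
  obtain w :: "nat \<Rightarrow> _ \<Rightarrow> real" and Z :: "nat \<Rightarrow> _ \<Rightarrow> 'x" where w: "AE \<omega> in N. (\<lambda>j. w j \<omega>) sums 1"
      "\<forall>j. \<forall>\<omega>\<in>space N. 0 \<le> w j \<omega>"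
    and p: "\<forall>\<omega>\<in>space N. sets (p \<omega>) = sets borel \<and>
           (\<forall>A\<in>sets borel. emeasure (p \<omega>) A = (\<Sum>j. ennreal (w j \<omega>) * indicator A (Z j \<omega>)))"
    using SS unfolding SSrp_def by (elim exE conjE) (rule that)
  show ?thesis
    using w(1) AE_space
  proof eventually_elim
    case (elim \<omega>)
    then have "(\<lambda>j. ennreal (w j \<omega>)) sums ennreal 1"
      by (subst sums_ennreal) (auto simp: w)
    then have "emeasure (p \<omega>) UNIV = 1"
      using p elim by (simp add: sums_iff)
    then show ?case
      by (simp add: measure_def)
  qed
qed

text \<open>The expansion is carried out with extended nonnegative values and transferred to the
  reals at both ends.\<close>

lemma SSrp_moment:
  fixes H0 :: "'x::topological_space measure"
  assumes N: "prob_space N" and H0: "prob_space H0" and SS: "SSrp N p q0 H0" and m: "m \<ge> 1"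
    and D: "\<And>k. k \<in> {1..m} \<Longrightarrow> D k \<in> sets borel"
  shows "(\<integral>\<omega>. (\<Prod>k\<in>{1..m}. measure (p \<omega>) (D k)) \<partial>N) =
    (\<Sum>P\<in>partitions m. q0 (block_sizes P) * (\<Prod>B\<in>P. measure H0 (\<Inter>k\<in>B. D k)))"
proof -
  interpret N: prob_space N by fact
  interpret H0: prob_space H0 by fact
  from SS obtain w Z where raw:
      "\<forall>j. w j \<in> borel_measurable N" "\<forall>j. \<forall>\<omega>\<in>space N. 0 \<le> w j \<omega>"
      "AE \<omega> in N. (\<lambda>j. w j \<omega>) sums 1"
      "N.indep_vars (\<lambda>_. borel) Z UNIV" "\<forall>j. distr N borel (Z j) = H0"
    and wZ: "N.indep_set
          (gen_events N (\<Pi>\<^sub>M j\<in>UNIV. borel) (\<lambda>\<omega> j. w j \<omega>))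
          (gen_events N (\<Pi>\<^sub>M j\<in>UNIV. borel) (\<lambda>\<omega> j. Z j \<omega>))"
    and p_raw: "\<forall>\<omega>\<in>space N. sets (p \<omega>) = sets borel \<and>
           (\<forall>A\<in>sets borel. emeasure (p \<omega>) A = (\<Sum>j. ennreal (w j \<omega>) * indicator A (Z j \<omega>)))"
    and q0_raw: "\<forall>ns. ns \<noteq> [] \<longrightarrow> 0 \<notin> set ns \<longrightarrow>
           q0 ns = (\<Sum>\<^sub>\<infinity>js\<in>{js. length js = length ns \<and> distinct js}.
                      \<integral>\<omega>. (\<Prod>i<length ns. w (js ! i) \<omega> ^ (ns ! i)) \<partial>N)"
    unfolding SSrp_def by (elim exE conjE) (rule that)
  have w: "\<And>j. w j \<in> borel_measurable N" "\<And>j. \<forall>\<omega>\<in>space N. 0 \<le> w j \<omega>"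
      "AE \<omega> in N. (\<lambda>j. w j \<omega>) sums 1"
    and Z: "N.indep_vars (\<lambda>_. borel) Z UNIV" "\<And>j. distr N borel (Z j) = H0"
    using raw by simp_all
  have p: "emeasure (p \<omega>) A = (\<Sum>j. ennreal (w j \<omega>) * indicator A (Z j \<omega>))"
    if "\<omega> \<in> space N" "A \<in> sets borel" for \<omega> A
    using p_raw that by blast
  note ctx = N.prob_space_axioms H0 w Z wZ
  \<comment> \<open>The formula for \<open>q0\<close> covers nonempty lists of positive sizes. The
    list is nonempty by \<open>m \<ge> 1\<close>, and its entries are positive because blocks are
    nonempty and finite.\<close>
  have q0_eq: "ennreal (q0 (block_sizes P)) = (\<integral>\<^sup>+xs. weight_moment N w (block_sizes P) xs
       \<partial>count_space {xs. length xs = card P \<and> distinct xs})"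
    and q0_nonneg: "0 \<le> q0 (block_sizes P)" if P: "P \<in> partitions m" for P
  proof -
    have len: "length (block_sizes P) = card P"
      by (simp add: block_sizes_def length_blocks[OF P])
    have "P \<noteq> {}"
      using partitions_Union[OF P] m by auto
    then have "block_sizes P \<noteq> []"
      using len partitions_finite[OF P] by auto
    moreover have "0 \<notin> set (block_sizes P)"
      using partitions_block_finite[OF P] partitions_block_nonempty[OF P]
      by (auto simp: block_sizes_def set_blocks[OF P])
    ultimately have q0: "q0 (block_sizes P) = (\<Sum>\<^sub>\<infinity>xs\<in>{xs. length xs = card P \<and> distinct xs}.
        \<integral>\<omega>. (\<Prod>c<card P. w (xs ! c) \<omega> ^ (block_sizes P ! c)) \<partial>N)"
      using q0_raw len by (simp cong: conj_cong)
    show "ennreal (q0 (block_sizes P)) = (\<integral>\<^sup>+xs. weight_moment N w (block_sizes P) xs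
       \<partial>count_space {xs. length xs = card P \<and> distinct xs})"
      unfolding q0 by (rule infsum_weight_moment[OF ctx P])
    show "0 \<le> q0 (block_sizes P)"
      unfolding q0 using w(2) by (intro infsum_nonneg integral_nonneg_AE AE_I2 prod_nonneg) auto
  qed
  \<comment> \<open>\<open>measure\<close> sends infinite mass to 0, so finiteness has to be secured
    first; the total weight 1 bounds the mass.\<close>
  have eq: "ennreal (measure (p \<omega>) A) = emeasure (p \<omega>) A"
    if "\<omega> \<in> space N" "A \<in> sets borel" "(\<Sum>j. ennreal (w j \<omega>)) = 1" for \<omega> A
  proof -
    have "emeasure (p \<omega>) A \<le> (\<Sum>j. ennreal (w j \<omega>))"
      unfolding p[OF that(1,2)] by (intro suminf_le) (auto simp: indicator_def)
    then show ?thesis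
      using that(3) by (intro emeasure_eq_ennreal_measure[symmetric]) (auto simp: top_unique)
  qed
  have "(\<integral>\<omega>. (\<Prod>k\<in>{1..m}. measure (p \<omega>) (D k)) \<partial>N) =
      enn2real (\<integral>\<^sup>+\<omega>. ennreal (\<Prod>k\<in>{1..m}. measure (p \<omega>) (D k)) \<partial>N)"
    using SSrp_measurable[OF N SS] D
    by (intro integral_eq_nn_integral borel_measurable_prod) (auto intro!: prod_nonneg)
  also have "(\<integral>\<^sup>+\<omega>. ennreal (\<Prod>k\<in>{1..m}. measure (p \<omega>) (D k)) \<partial>N) =
      (\<integral>\<^sup>+\<omega>. (\<Prod>k\<in>{1..m}. \<Sum>j. ennreal (w j \<omega>) * indicator (D k) (Z j \<omega>)) \<partial>N)"
  proof (rule nn_integral_cong_AE)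
    show "AE \<omega> in N. ennreal (\<Prod>k\<in>{1..m}. measure (p \<omega>) (D k)) =
        (\<Prod>k\<in>{1..m}. \<Sum>j. ennreal (w j \<omega>) * indicator (D k) (Z j \<omega>))"
      using suminf_weights_eq_1[OF ctx] AE_space
    proof eventually_elim
      case (elim \<omega>)
      have "ennreal (\<Prod>k\<in>{1..m}. measure (p \<omega>) (D k)) = (\<Prod>k\<in>{1..m}. ennreal (measure (p \<omega>) (D k)))"
        by (rule prod_ennreal[symmetric]) simp
      also have "\<dots> = (\<Prod>k\<in>{1..m}. \<Sum>j. ennreal (w j \<omega>) * indicator (D k) (Z j \<omega>))"
        using elim D by (intro prod.cong) (simp_all add: eq p)
      finally show ?case .
    qed
  qed
  also have "\<dots> = (\<Sum>P\<in>partitions m. ennreal (q0 (block_sizes P)) * (\<Prod>B\<in>P. emeasure H0 (\<Inter>k\<in>B. D k)))"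
    using nn_integral_prod_suminf[OF ctx, of m D] D by (simp add: q0_eq)
  also have "\<dots> = (\<Sum>P\<in>partitions m. ennreal (q0 (block_sizes P) * (\<Prod>B\<in>P. measure H0 (\<Inter>k\<in>B. D k))))"
    using q0_nonneg
    by (intro sum.cong) (auto simp: H0.emeasure_eq_measure prod_ennreal ennreal_mult prod_nonneg)
  also have "\<dots> = ennreal (\<Sum>P\<in>partitions m. q0 (block_sizes P) * (\<Prod>B\<in>P. measure H0 (\<Inter>k\<in>B. D k)))"
    using q0_nonneg by (intro sum_ennreal) (auto intro!: mult_nonneg_nonneg prod_nonneg)
  finally show ?thesis
    using q0_nonneg by (simp add: sum_nonneg prod_nonneg)
qed

section \<open>Cells of the array\<close>

text \<open>The finite-level form of \<open>cell_index\<close>: each \<open>\<pi> i\<close> is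
  already the partition at the level of group \<open>i\<close>.\<close>

definition cell_number :: "(nat \<Rightarrow> nat set set) \<Rightarrow> nat \<Rightarrow> nat \<Rightarrow> nat" where
  "cell_number \<pi> i c = (\<Sum>i'\<in>{1..<i}. card (\<pi> i')) + c"

text \<open>The offset of a later group already counts all blocks of group \<open>i\<close>.\<close>

lemma cell_number_less:
  assumes "1 \<le> i" "i < i'" "c \<le> card (\<pi> i)" "1 \<le> c'"
  shows "cell_number \<pi> i c < cell_number \<pi> i' c'"
proof -
  have "(\<Sum>l\<in>{1..<i}. card (\<pi> l)) + card (\<pi> i) = (\<Sum>l\<in>{1..<Suc i}. card (\<pi> l))"
    using assms(1) by simp
  also have "\<dots> \<le> (\<Sum>l\<in>{1..<i'}. card (\<pi> l))"
    using assms(2) by (intro sum_mono2) auto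
  finally show ?thesis
    using assms by (simp add: cell_number_def)
qed

lemma cell_number_inj:
  assumes "1 \<le> i" "1 \<le> i'" "c \<in> {1..card (\<pi> i)}" "c' \<in> {1..card (\<pi> i')}"
    and "cell_number \<pi> i c = cell_number \<pi> i' c'"
  shows "i = i' \<and> c = c'"
proof -
  have "i = i'"
    using assms cell_number_less[of i i' c \<pi> c'] cell_number_less[of i' i c' \<pi> c]
    by (cases i i' rule: linorder_cases) auto
  then show ?thesis
    using assms(5) by (simp add: cell_number_def)
qed

text \<open>A group has at most as many blocks as observations. Hence the total sample size bounds
  all cell numbers, whatever the group partitions are, and can serve as the fixed top level.\<close>

lemma cell_number_in:
  assumes \<pi>: "\<And>i. i \<in> {1..I} \<Longrightarrow> \<pi> i \<in> partitions (n i)" and i: "i \<in> {1..I}"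
    and c: "c \<in> {1..card (\<pi> i)}"
  shows "cell_number \<pi> i c \<in> {1..\<Sum>i\<in>{1..I}. n i}"
proof -
  have "(\<Sum>l\<in>{1..<i}. card (\<pi> l)) + card (\<pi> i) = (\<Sum>l\<in>{1..<Suc i}. card (\<pi> l))"
    using i by simp
  also have "\<dots> \<le> (\<Sum>l\<in>{1..<Suc i}. n l)"
    using i by (intro sum_mono partitions_card_le \<pi>) auto
  also have "\<dots> \<le> (\<Sum>l\<in>{1..I}. n l)"
    using i by (intro sum_mono2) auto
  finally show ?thesis
    using c by (simp add: cell_number_def)
qed

text \<open>The joint constraint on the value shared by the observations of cell \<open>k\<close>.
  If \<open>k\<close> is not the number of a cell, the condition is vacuous and the set is the whole
  space.\<close>

definition cell_set ::
    "nat \<Rightarrow> (nat \<Rightarrow> nat) \<Rightarrow> (nat \<Rightarrow> nat \<Rightarrow> 'x set) \<Rightarrow> (nat \<Rightarrow> nat set set) \<Rightarrow> nat \<Rightarrow> 'x set" where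
  "cell_set I n A \<pi> k =
     {x. \<forall>i\<in>{1..I}. \<forall>j\<in>{1..n i}. cell_number \<pi> i (block_number (\<pi> i) j) = k \<longrightarrow> x \<in> A i j}"

lemma cell_set_measurable:
  fixes A :: "nat \<Rightarrow> nat \<Rightarrow> 'x::topological_space set"
  assumes "\<And>i j. A i j \<in> sets borel"
  shows "cell_set I n A \<pi> k \<in> sets borel"
proof -
  have "cell_set I n A \<pi> k = (\<Inter>i\<in>{1..I}. \<Inter>j\<in>{1..n i}.
      if cell_number \<pi> i (block_number (\<pi> i) j) = k then A i j else UNIV)"
    by (auto simp: cell_set_def split: if_splits)
  also have "\<dots> \<in> sets borel"
    using assms by (intro sets.countable_INT'' countable_finite) auto
  finally show ?thesis .
qed

text \<open>Pairs of group and block are reindexed by their cell numbers. The range of the product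
  is then extended to all numbers up to the total sample size by factors
  \<open>g UNIV = 1\<close>.\<close>

lemma prod_cells:
  fixes g :: "'x set \<Rightarrow> 'c::comm_monoid_mult"
  assumes \<pi>: "\<And>i. i \<in> {1..I} \<Longrightarrow> \<pi> i \<in> partitions (n i)" and g: "g UNIV = 1"
  shows "(\<Prod>i\<in>{1..I}. \<Prod>B\<in>\<pi> i. g (\<Inter>j\<in>B. A i j)) =
    (\<Prod>k\<in>{1..\<Sum>i\<in>{1..I}. n i}. g (cell_set I n A \<pi> k))"
proof -
  let ?T = "SIGMA i:{1..I}. {1..card (\<pi> i)}"
  let ?h = "\<lambda>(i, c). cell_number \<pi> i c"
  \<comment> \<open>Cell numbers are injective, so an observation constrains this cell only if it
    belongs to that very group and block.\<close>
  have set_eq: "cell_set I n A \<pi> (cell_number \<pi> i c) = (\<Inter>j\<in>block (\<pi> i) c. A i j)"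
    if i: "i \<in> {1..I}" and c: "c \<in> {1..card (\<pi> i)}" for i c
  proof -
    have "cell_number \<pi> i' (block_number (\<pi> i') j) = cell_number \<pi> i c \<longleftrightarrow> i' = i \<and> j \<in> block (\<pi> i) c"
      if i': "i' \<in> {1..I}" "j \<in> {1..n i'}" for i' j
      using cell_number_inj[of i' i "block_number (\<pi> i') j" \<pi> c] block_number_in[OF \<pi>[OF i'(1)] i'(2)]
        in_block_iff[OF \<pi>[OF i] c] i c i' by auto
    then show ?thesis
      using i block_subset[OF \<pi>[OF i] c] unfolding cell_set_def by auto
  qed
  have inj: "inj_on ?h ?T"
  proof (rule inj_onI)
    fix x y assume "x \<in> ?T" "y \<in> ?T" "?h x = ?h y"
    then show "x = y"
      using cell_number_inj[of "fst x" "fst y" "snd x" \<pi> "snd y"] by (auto simp: prod_eq_iff)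
  qed
  have "(\<Prod>i\<in>{1..I}. \<Prod>B\<in>\<pi> i. g (\<Inter>j\<in>B. A i j)) =
      (\<Prod>i\<in>{1..I}. \<Prod>c\<in>{1..card (\<pi> i)}. g (\<Inter>j\<in>block (\<pi> i) c. A i j))"
    by (intro prod.cong refl prod.reindex_bij_betw[OF bij_betw_block[OF \<pi>], symmetric])
  also have "\<dots> = (\<Prod>i\<in>{1..I}. \<Prod>c\<in>{1..card (\<pi> i)}. g (cell_set I n A \<pi> (cell_number \<pi> i c)))"
    by (intro prod.cong refl) (simp only: set_eq)
  also have "\<dots> = (\<Prod>x\<in>?T. g (cell_set I n A \<pi> (?h x)))"
    by (subst prod.Sigma) (auto simp: case_prod_beta)
  also have "\<dots> = (\<Prod>k\<in>?h ` ?T. g (cell_set I n A \<pi> k))"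
    by (rule prod.reindex[OF inj, unfolded comp_def, symmetric])
  also have "\<dots> = (\<Prod>k\<in>{1..\<Sum>i\<in>{1..I}. n i}. g (cell_set I n A \<pi> k))"
  proof (rule prod.mono_neutral_left)
    show "?h ` ?T \<subseteq> {1..\<Sum>i\<in>{1..I}. n i}"
    proof (rule image_subsetI)
      fix x assume "x \<in> ?T"
      then show "?h x \<in> {1..\<Sum>i\<in>{1..I}. n i}"
        using cell_number_in[of I \<pi> n "fst x" "snd x"] \<pi>
        by (auto simp del: atLeastAtMost_iff)
    qed
    \<comment> \<open>No observation falls into such a \<open>k\<close>, so its set is the whole
      space.\<close>
    show "\<forall>k\<in>{1..\<Sum>i\<in>{1..I}. n i} - ?h ` ?T. g (cell_set I n A \<pi> k) = 1"
    proof
      fix k assume k: "k \<in> {1..\<Sum>i\<in>{1..I}. n i} - ?h ` ?T"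
      have "cell_number \<pi> i (block_number (\<pi> i) j) \<noteq> k" if "i \<in> {1..I}" "j \<in> {1..n i}" for i j
        using block_number_in[OF \<pi>[OF that(1)] that(2)] that(1) k by force
      then have "cell_set I n A \<pi> k = UNIV"
        by (auto simp: cell_set_def)
      then show "g (cell_set I n A \<pi> k) = 1"
        by (simp add: g)
    qed
  qed simp
  finally show ?thesis .
qed

text \<open>For fixed group partitions the mixed moment becomes a product over cell numbers, to
  which the moment formula applies with \<open>cell_set\<close> in place of
  \<open>D\<close>.\<close>

lemma HSSM_rectangle:
  fixes H0 :: "'x::topological_space measure"
  assumes N: "prob_space N" and H0: "prob_space H0" and HS: "HSSM M I \<xi> N p q q0 H0"
    and I: "1 \<le> I" and n: "\<And>i. i \<in> {1..I} \<Longrightarrow> 1 \<le> n i" and A: "\<And>i j. A i j \<in> sets borel"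
  shows "measure M {\<omega> \<in> space M. \<forall>i\<in>{1..I}. \<forall>j\<in>{1..n i}. \<xi> i j \<omega> \<in> A i j} =
    (\<Sum>\<pi>\<in>(\<Pi>\<^sub>E i\<in>{1..I}. partitions (n i)). \<Sum>P\<in>partitions (\<Sum>i\<in>{1..I}. n i).
       (\<Prod>i\<in>{1..I}. q (block_sizes (\<pi> i))) * q0 (block_sizes P) *
       (\<Prod>B\<in>P. measure H0 (\<Inter>k\<in>B. cell_set I n A \<pi> k)))"
proof -
  have SS: "SSrp N p q0 H0"
    using HS by (simp add: HSSM_def)
  have "n 1 \<le> (\<Sum>i\<in>{1..I}. n i)"
    using I by (intro member_le_sum) auto
  then have m: "1 \<le> (\<Sum>i\<in>{1..I}. n i)"
    using n[of 1] I by simp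
  have moment: "(\<integral>\<omega>. (\<Prod>i\<in>{1..I}. \<Prod>B\<in>\<pi> i. measure (p \<omega>) (\<Inter>j\<in>B. A i j)) \<partial>N) =
      (\<Sum>P\<in>partitions (\<Sum>i\<in>{1..I}. n i). q0 (block_sizes P) *
        (\<Prod>B\<in>P. measure H0 (\<Inter>k\<in>B. cell_set I n A \<pi> k)))"
    if "\<pi> \<in> (\<Pi>\<^sub>E i\<in>{1..I}. partitions (n i))" for \<pi>
  proof -
    have \<pi>: "\<pi> i \<in> partitions (n i)" if "i \<in> {1..I}" for i
      using that \<open>\<pi> \<in> _\<close> by auto
    have "(\<integral>\<omega>. (\<Prod>i\<in>{1..I}. \<Prod>B\<in>\<pi> i. measure (p \<omega>) (\<Inter>j\<in>B. A i j)) \<partial>N) =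
        (\<integral>\<omega>. (\<Prod>k\<in>{1..\<Sum>i\<in>{1..I}. n i}. measure (p \<omega>) (cell_set I n A \<pi> k)) \<partial>N)"
    proof (rule integral_cong_AE)
      \<comment> \<open>The padding uses total mass 1, which is available almost surely.\<close>
      show "AE \<omega> in N. (\<Prod>i\<in>{1..I}. \<Prod>B\<in>\<pi> i. measure (p \<omega>) (\<Inter>j\<in>B. A i j)) =
          (\<Prod>k\<in>{1..\<Sum>i\<in>{1..I}. n i}. measure (p \<omega>) (cell_set I n A \<pi> k))"
        using SSrp_AE_measure_UNIV[OF SS] by eventually_elim (rule prod_cells[OF \<pi>])
      show "(\<lambda>\<omega>. \<Prod>k\<in>{1..\<Sum>i\<in>{1..I}. n i}. measure (p \<omega>) (cell_set I n A \<pi> k)) \<in> borel_measurable N"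
        by (intro borel_measurable_prod SSrp_measurable[OF N SS] cell_set_measurable A)
      show "(\<lambda>\<omega>. \<Prod>i\<in>{1..I}. \<Prod>B\<in>\<pi> i. measure (p \<omega>) (\<Inter>j\<in>B. A i j)) \<in> borel_measurable N"
      proof (intro borel_measurable_prod SSrp_measurable[OF N SS])
        fix i B assume "i \<in> {1..I}" "B \<in> \<pi> i"
        then show "(\<Inter>j\<in>B. A i j) \<in> sets borel"
          using partitions_block_finite[OF \<pi>] A by (intro sets.countable_INT'' countable_finite) auto
      qed
    qed
    also have "\<dots> = (\<Sum>P\<in>partitions (\<Sum>i\<in>{1..I}. n i). q0 (block_sizes P) *
        (\<Prod>B\<in>P. measure H0 (\<Inter>k\<in>B. cell_set I n A \<pi> k)))"
      by (intro SSrp_moment[OF N H0 SS m] cell_set_measurable A)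
    finally show ?thesis .
  qed
  have "measure M {\<omega> \<in> space M. \<forall>i\<in>{1..I}. \<forall>j\<in>{1..n i}. \<xi> i j \<omega> \<in> A i j} =
        (\<Sum>\<pi>\<in>(\<Pi>\<^sub>E i\<in>{1..I}. partitions (n i)).
           (\<Prod>i\<in>{1..I}. q (block_sizes (\<pi> i))) *
           (\<integral>\<omega>. (\<Prod>i\<in>{1..I}. \<Prod>B\<in>\<pi> i. measure (p \<omega>) (\<Inter>j\<in>B. A i j)) \<partial>N))"
    using HS n A unfolding HSSM_def by blast
  also have "\<dots> = (\<Sum>\<pi>\<in>(\<Pi>\<^sub>E i\<in>{1..I}. partitions (n i)). \<Sum>P\<in>partitions (\<Sum>i\<in>{1..I}. n i).
       (\<Prod>i\<in>{1..I}. q (block_sizes (\<pi> i))) * q0 (block_sizes P) *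
       (\<Prod>B\<in>P. measure H0 (\<Inter>k\<in>B. cell_set I n A \<pi> k)))"
    by (intro sum.cong refl) (simp only: moment sum_distrib_left mult.assoc)
  finally show ?thesis .
qed

section \<open>The array driven by random partitions\<close>

context
  fixes \<Omega> :: "'c measure" and H0 :: "'x::topological_space measure"
    and I :: nat and n :: "nat \<Rightarrow> nat" and q q0 :: "nat list \<Rightarrow> real"
    and \<phi> :: "nat \<Rightarrow> 'c \<Rightarrow> 'x" and R :: "nat \<Rightarrow> 'c \<Rightarrow> nat \<Rightarrow> nat set set"
  assumes prob: "prob_space \<Omega>"
    and \<phi>: "\<forall>k\<ge>1. \<phi> k \<in> measurable \<Omega> borel \<and> distr \<Omega> borel (\<phi> k) = H0"
    and R: "\<forall>i\<in>{1..I}. has_EPPF \<Omega> (R i) q" and R0: "has_EPPF \<Omega> (R 0) q0"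
    and indep: "prob_space.indep_sets \<Omega>
           (case_sum (\<lambda>k. gen_events \<Omega> borel (\<phi> k)) (\<lambda>i. gen_events \<Omega> partition_space (R i)))
           ({1..} <+> {0..I})"
begin

interpretation \<Omega>: prob_space \<Omega> by (rule prob)

abbreviation (input) total :: nat where "total \<equiv> \<Sum>i\<in>{1..I}. n i"

lemma R_measurable: "i \<in> {0..I} \<Longrightarrow> R i \<in> measurable \<Omega> partition_space"
  and R_consistent: "i \<in> {0..I} \<Longrightarrow> \<omega> \<in> space \<Omega> \<Longrightarrow> l \<le> m \<Longrightarrow>
    R i \<omega> l = (\<lambda>B. B \<inter> {1..l}) ` R i \<omega> m - {{}}"
proof -
  have "exchangeable_random_partition \<Omega> (R i)" if "i \<in> {0..I}" for i
    using R R0 that by (cases "i = 0") (simp_all add: has_EPPF_def)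
  then show "i \<in> {0..I} \<Longrightarrow> R i \<in> measurable \<Omega> partition_space"
    "i \<in> {0..I} \<Longrightarrow> \<omega> \<in> space \<Omega> \<Longrightarrow> l \<le> m \<Longrightarrow>
      R i \<omega> l = (\<lambda>B. B \<inter> {1..l}) ` R i \<omega> m - {{}}"
    unfolding exchangeable_random_partition_def by blast+
qed

lemma R_in_partitions: "i \<in> {0..I} \<Longrightarrow> \<omega> \<in> space \<Omega> \<Longrightarrow> R i \<omega> m \<in> partitions m"
  using measurable_space[OF R_measurable] by (fastforce simp: partition_space_def space_PiM)

text \<open>Membership in the generated family, and not just in \<open>sets \<Omega>\<close>, is
  what allows the independence hypothesis to be applied.\<close>

lemma R_event:
  assumes i: "i \<in> {0..I}"
  shows "{\<omega> \<in> space \<Omega>. R i \<omega> m = P} \<in> gen_events \<Omega> partition_space (R i)"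
proof -
  \<comment> \<open>Intersecting \<open>{P}\<close> with \<open>partitions m\<close> gives a set of
    the count space for every \<open>P\<close> and leaves the event unchanged.\<close>
  have "{x \<in> space partition_space. x m = P} = (\<lambda>x. x m) -` ({P} \<inter> partitions m) \<inter> space partition_space"
    by (auto simp: partition_space_def space_PiM)
  also have "\<dots> \<in> sets partition_space"
    unfolding partition_space_def by (rule measurable_sets[OF measurable_component_singleton]) auto
  finally have "R i -` {x \<in> space partition_space. x m = P} \<inter> space \<Omega> \<in> gen_events \<Omega> partition_space (R i)"
    unfolding gen_events_def by (rule in_vimage_algebra)
  also have "R i -` {x \<in> space partition_space. x m = P} \<inter> space \<Omega> = {\<omega> \<in> space \<Omega>. R i \<omega> m = P}"
    using measurable_space[OF R_measurable[OF i]] by auto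
  finally show ?thesis .
qed

lemma R_event_sets: "i \<in> {0..I} \<Longrightarrow> {\<omega> \<in> space \<Omega>. R i \<omega> m = P} \<in> sets \<Omega>"
proof -
  assume i: "i \<in> {0..I}"
  have "\<forall>x\<in>{1..} <+> {0..I}. case_sum (\<lambda>k. gen_events \<Omega> borel (\<phi> k))
      (\<lambda>i. gen_events \<Omega> partition_space (R i)) x \<subseteq> sets \<Omega>"
    using indep unfolding \<Omega>.indep_sets_def by (rule conjunct1)
  from bspec[OF this InrI[OF i]] have "gen_events \<Omega> partition_space (R i) \<subseteq> sets \<Omega>"
    by simp
  then show ?thesis
    using R_event[OF i] by blast
qed

text \<open>Once the partitions at the levels \<open>n i\<close> and \<open>total\<close> are fixed,
  the random index becomes a deterministic function of them.\<close>

lemma dstar_eq: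
  assumes \<omega>: "\<omega> \<in> space \<Omega>" and ij: "i \<in> {1..I}" "j \<in> {1..n i}"
    and \<pi>: "\<And>i. i \<in> {1..I} \<Longrightarrow> R i \<omega> (n i) = \<pi> i" and P: "R 0 \<omega> total = P"
  shows "dstar n (\<lambda>i'. R i' \<omega>) i j = block_number P (cell_number \<pi> i (block_number (\<pi> i) j))"
proof -
  have \<pi>_part: "\<pi> i \<in> partitions (n i)" if "i \<in> {1..I}" for i
    using R_in_partitions[of i \<omega> "n i"] \<omega> that \<pi> by simp
  have "block_index (R i \<omega>) j = block_number (\<pi> i) j"
    using R_in_partitions R_consistent \<omega> ij \<pi>
    by (subst block_index_eq_block_number[of "R i \<omega>" j "n i"]) auto
  moreover have "cell_index n (\<lambda>i'. R i' \<omega>) i c = cell_number \<pi> i c" for c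
    using ij \<pi> by (simp add: cell_index_def cell_number_def)
  moreover have "block_index (R 0 \<omega>) k = block_number P k" if "k \<in> {1..total}" for k
    using R_in_partitions R_consistent \<omega> that P
    by (subst block_index_eq_block_number[of "R 0 \<omega>" k total]) auto
  \<comment> \<open>This lets the top-level index be read off at level \<open>total\<close>.\<close>
  moreover have "cell_number \<pi> i (block_number (\<pi> i) j) \<in> {1..total}"
    by (rule cell_number_in[of I \<pi> n i])
      (use \<pi>_part ij(1) block_number_in[OF \<pi>_part[OF ij(1)] ij(2)] in simp_all)
  ultimately show ?thesis
    by (simp add: dstar_def)
qed

text \<open>Independence turns the probability into a product: the EPPFs give the factors of the
  partitions and \<open>H0\<close> those of the atoms. The EPPF formula starts at level 1, hence the
  lower bounds on \<open>n i\<close> and \<open>m\<close>.\<close>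

lemma prob_partitions_atoms:
  assumes \<pi>: "\<And>i. i \<in> {1..I} \<Longrightarrow> \<pi> i \<in> partitions (n i)" and P: "P \<in> partitions m"
    and n: "\<And>i. i \<in> {1..I} \<Longrightarrow> 1 \<le> n i" and m: "1 \<le> m" and G: "\<And>d. G d \<in> sets borel"
  shows "measure \<Omega> {\<omega> \<in> space \<Omega>. (\<forall>i\<in>{1..I}. R i \<omega> (n i) = \<pi> i) \<and> R 0 \<omega> m = P \<and>
      (\<forall>d\<in>{1..r}. \<phi> d \<omega> \<in> G d)} =
    (\<Prod>i\<in>{1..I}. q (block_sizes (\<pi> i))) * q0 (block_sizes P) * (\<Prod>d\<in>{1..r}. measure H0 (G d))"
proof -
  let ?J = "{1..r} <+> {0..I}"
  \<comment> \<open>The index type is that of the independence hypothesis: \<open>Inl d\<close> for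
    atoms, \<open>Inr 0\<close> for the top-level partition, \<open>Inr i\<close> with positive
    \<open>i\<close> for the groups.\<close>
  define E where "E x = (case x of Inl d \<Rightarrow> \<phi> d -` G d \<inter> space \<Omega>
    | Inr i \<Rightarrow> if i = 0 then {\<omega> \<in> space \<Omega>. R 0 \<omega> m = P} else {\<omega> \<in> space \<Omega>. R i \<omega> (n i) = \<pi> i})" for x
  have "{\<omega> \<in> space \<Omega>. (\<forall>i\<in>{1..I}. R i \<omega> (n i) = \<pi> i) \<and> R 0 \<omega> m = P \<and>
      (\<forall>d\<in>{1..r}. \<phi> d \<omega> \<in> G d)} = (\<Inter>x\<in>?J. E x)" (is "?X = _")
  proof (intro equalityI subsetI)
    fix \<omega> assume "\<omega> \<in> ?X"
    then show "\<omega> \<in> (\<Inter>x\<in>?J. E x)"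
      by (auto simp: E_def)
  next
    fix \<omega> assume "\<omega> \<in> (\<Inter>x\<in>?J. E x)"
    then have *: "\<omega> \<in> E x" if "x \<in> ?J" for x
      using that by blast
    have "\<omega> \<in> space \<Omega> \<and> R 0 \<omega> m = P"
      using *[OF InrI, of 0] by (simp add: E_def)
    moreover have "R i \<omega> (n i) = \<pi> i" if "i \<in> {1..I}" for i
      using *[OF InrI, of i] that by (simp add: E_def)
    moreover have "\<phi> d \<omega> \<in> G d" if "d \<in> {1..r}" for d
      using *[OF InlI, of d] that by (simp add: E_def)
    ultimately show "\<omega> \<in> ?X" by blast
  qed
  also have "measure \<Omega> (\<Inter>x\<in>?J. E x) = (\<Prod>x\<in>?J. measure \<Omega> (E x))"
  proof (rule \<Omega>.indep_setsD[OF indep])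
    show "\<forall>x\<in>?J. E x \<in> case_sum (\<lambda>k. gen_events \<Omega> borel (\<phi> k)) (\<lambda>i. gen_events \<Omega> partition_space (R i)) x"
    proof
      fix x assume x: "x \<in> ?J"
      show "E x \<in> case_sum (\<lambda>k. gen_events \<Omega> borel (\<phi> k)) (\<lambda>i. gen_events \<Omega> partition_space (R i)) x"
      proof (cases x)
        case (Inl d)
        then show ?thesis
          using in_vimage_algebra[OF G] by (simp add: E_def gen_events_def)
      next
        case (Inr i)
        then show ?thesis
          using x R_event by (auto simp: E_def)
      qed
    qed
  qed auto
  also have "\<dots> = (\<Prod>d\<in>{1..r}. measure \<Omega> (E (Inl d))) * (\<Prod>i\<in>{0..I}. measure \<Omega> (E (Inr i)))"
    by (simp add: prod.Plus)
  also have "(\<Prod>d\<in>{1..r}. measure \<Omega> (E (Inl d))) = (\<Prod>d\<in>{1..r}. measure H0 (G d))"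
  proof (rule prod.cong[OF refl])
    fix d assume d: "d \<in> {1..r}"
    then have "measure H0 (G d) = measure (distr \<Omega> borel (\<phi> d)) (G d)"
      using \<phi> by simp
    also have "\<dots> = measure \<Omega> (E (Inl d))"
      using \<phi> d G by (subst measure_distr) (auto simp: E_def)
    finally show "measure \<Omega> (E (Inl d)) = measure H0 (G d)" ..
  qed
  also have "(\<Prod>i\<in>{0..I}. measure \<Omega> (E (Inr i))) =
      measure \<Omega> (E (Inr 0)) * (\<Prod>i\<in>{1..I}. measure \<Omega> (E (Inr i)))"
    by (simp add: prod.atLeast_Suc_atMost)
  also have "measure \<Omega> (E (Inr 0)) = q0 (block_sizes P)"
    using R0 P m by (simp add: E_def has_EPPF_def)
  also have "(\<Prod>i\<in>{1..I}. measure \<Omega> (E (Inr i))) = (\<Prod>i\<in>{1..I}. q (block_sizes (\<pi> i)))"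
    using R \<pi> n by (intro prod.cong) (auto simp: E_def has_EPPF_def)
  finally show ?thesis
    by (simp add: mult_ac)
qed

text \<open>The target is finite, so it suffices that the preimages of points are finite
  intersections of events.\<close>

lemma measurable_levels:
  "(\<lambda>\<omega>. (\<lambda>i\<in>{1..I}. R i \<omega> (n i), R 0 \<omega> m)) \<in>
     measurable \<Omega> (count_space ((\<Pi>\<^sub>E i\<in>{1..I}. partitions (n i)) \<times> partitions m))"
    (is "?T \<in> measurable \<Omega> (count_space ?Q)")
proof -
  have "finite ?Q"
    by (intro finite_cartesian_product finite_PiE finite_partitions) auto
  moreover have "?T \<in> space \<Omega> \<rightarrow> ?Q"
    using R_in_partitions by auto
  moreover have "?T -` {x} \<inter> space \<Omega> \<in> sets \<Omega>" if "x \<in> ?Q" for x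
  proof -
    have "?T -` {x} \<inter> space \<Omega> = {\<omega> \<in> space \<Omega>. R 0 \<omega> m = snd x} \<inter>
        {\<omega> \<in> space \<Omega>. \<forall>i\<in>{1..I}. R i \<omega> (n i) = fst x i}"
      using that by (auto simp: fun_eq_iff PiE_def extensional_def restrict_def split: if_splits)
    also have "\<dots> \<in> sets \<Omega>"
      using R_event_sets by (intro sets.Int sets.sets_Collect_finite_All) auto
    finally show ?thesis .
  qed
  ultimately show ?thesis
    by (simp add: measurable_count_space_eq2)
qed

text \<open>The index is random but depends only on finitely many partitions at fixed levels, so the
  variable is patched together from countably many fixed \<open>\<phi> d\<close>.\<close>

lemma measurable_dstar:
  assumes ij: "i \<in> {1..I}" "j \<in> {1..n i}"
  shows "(\<lambda>\<omega>. \<phi> (dstar n (\<lambda>i'. R i' \<omega>) i j) \<omega>) \<in> measurable \<Omega> borel"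
proof -
  let ?Q = "(\<Pi>\<^sub>E i\<in>{1..I}. partitions (n i)) \<times> partitions total"
  let ?T = "\<lambda>\<omega>. (\<lambda>i\<in>{1..I}. R i \<omega> (n i), R 0 \<omega> total)"
  let ?d = "\<lambda>(\<pi>, P). block_number P (cell_number \<pi> i (block_number (\<pi> i) j))"
  have "(\<lambda>\<omega>. \<phi> (?d (?T \<omega>)) \<omega>) \<in> measurable \<Omega> borel"
  proof (rule measurable_compose_countable'[OF _ measurable_levels])
    show "countable ?Q"
      by (intro countable_finite finite_cartesian_product finite_PiE finite_partitions) auto
    fix x assume x: "x \<in> ?Q"
    then obtain \<pi> P where x_eq: "x = (\<pi>, P)" and \<pi>: "\<And>i. i \<in> {1..I} \<Longrightarrow> \<pi> i \<in> partitions (n i)"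
      and P: "P \<in> partitions total"
      by (cases x) (auto simp: PiE_iff)
    have "cell_number \<pi> i (block_number (\<pi> i) j) \<in> {1..total}"
      by (rule cell_number_in[of I \<pi> n i])
        (use \<pi> ij(1) block_number_in[OF \<pi>[OF ij(1)] ij(2)] in simp_all)
    \<comment> \<open>Block numbers are at least 1, the range where \<open>\<phi>\<close> is assumed
      measurable.\<close>
    then have "?d x \<in> {1..card P}"
      using block_number_in[OF P] by (simp add: x_eq)
    then show "(\<lambda>\<omega>. \<phi> (?d x) \<omega>) \<in> measurable \<Omega> borel"
      using \<phi> by simp
  qed
  then show ?thesis
  proof (rule measurable_cong[THEN iffD1, rotated])
    fix \<omega> assume "\<omega> \<in> space \<Omega>"
    then show "\<phi> (?d (?T \<omega>)) \<omega> = \<phi> (dstar n (\<lambda>i'. R i' \<omega>) i j) \<omega>"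
      using dstar_eq[of \<omega> i j "fst (?T \<omega>)" "snd (?T \<omega>)"] ij by simp
  qed
qed

text \<open>The event is split by the finitely many values of the partitions at the levels used. On
  each piece the array depends only on the first \<open>card P\<close> atoms, and independence gives
  the probability.\<close>

lemma dstar_rectangle:
  assumes I: "1 \<le> I" and n: "\<And>i. i \<in> {1..I} \<Longrightarrow> 1 \<le> n i" and A: "\<And>i j. A i j \<in> sets borel"
  shows "measure \<Omega> {\<omega> \<in> space \<Omega>. \<forall>i\<in>{1..I}. \<forall>j\<in>{1..n i}. \<phi> (dstar n (\<lambda>i'. R i' \<omega>) i j) \<omega> \<in> A i j} =
    (\<Sum>\<pi>\<in>(\<Pi>\<^sub>E i\<in>{1..I}. partitions (n i)). \<Sum>P\<in>partitions total.
       (\<Prod>i\<in>{1..I}. q (block_sizes (\<pi> i))) * q0 (block_sizes P) *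
       (\<Prod>B\<in>P. measure H0 (\<Inter>k\<in>B. cell_set I n A \<pi> k)))"
proof -
  let ?Q = "(\<Pi>\<^sub>E i\<in>{1..I}. partitions (n i)) \<times> partitions total"
  let ?T = "\<lambda>\<omega>. (\<lambda>i\<in>{1..I}. R i \<omega> (n i), R 0 \<omega> total)"
  let ?X = "{\<omega> \<in> space \<Omega>. \<forall>i\<in>{1..I}. \<forall>j\<in>{1..n i}. \<phi> (dstar n (\<lambda>i'. R i' \<omega>) i j) \<omega> \<in> A i j}"
  define E where "E x = ?X \<inter> (?T -` {x} \<inter> space \<Omega>)" for x
  have X: "?X \<in> sets \<Omega>"
    using measurable_dstar A by (intro sets.sets_Collect_finite_All measurable_sets_Collect[of _ \<Omega> borel]) auto
  have finQ: "finite ?Q"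
    by (intro finite_cartesian_product finite_PiE finite_partitions) auto
  have "n 1 \<le> total"
    using I by (intro member_le_sum) auto
  then have m: "1 \<le> total"
    using n[of 1] I by simp
  have E_measure: "measure \<Omega> (E (\<pi>, P)) = (\<Prod>i\<in>{1..I}. q (block_sizes (\<pi> i))) * q0 (block_sizes P) *
       (\<Prod>B\<in>P. measure H0 (\<Inter>k\<in>B. cell_set I n A \<pi> k))"
    if \<pi>E: "\<pi> \<in> (\<Pi>\<^sub>E i\<in>{1..I}. partitions (n i))" and P: "P \<in> partitions total" for \<pi> P
  proof -
    have \<pi>: "\<pi> i \<in> partitions (n i)" if "i \<in> {1..I}" for i
      using that \<pi>E by auto
    \<comment> \<open>Atom \<open>d\<close> has to satisfy the constraints of all cells in block
      \<open>d\<close> of \<open>P\<close>. Outside the block numbers of \<open>P\<close> the empty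
      intersection gives the whole space.\<close>
    let ?G = "\<lambda>d. \<Inter>k\<in>(if d \<in> {1..card P} then block P d else {}). cell_set I n A \<pi> k"
    have G: "?G d \<in> sets borel" for d
      by (intro sets.countable_INT'' cell_set_measurable A) auto
    \<comment> \<open>Grouping the observations first by cell and then by block of \<open>P\<close>
      turns the conditions on the array into one condition for each atom.\<close>
    have iff: "(\<forall>i\<in>{1..I}. \<forall>j\<in>{1..n i}. \<phi> (dstar n (\<lambda>i'. R i' \<omega>) i j) \<omega> \<in> A i j) \<longleftrightarrow>
        (\<forall>d\<in>{1..card P}. \<phi> d \<omega> \<in> ?G d)"
      if \<omega>: "\<omega> \<in> space \<Omega>" and "\<forall>i\<in>{1..I}. R i \<omega> (n i) = \<pi> i" "R 0 \<omega> total = P" for \<omega>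
    proof -
      let ?k = "\<lambda>i j. cell_number \<pi> i (block_number (\<pi> i) j)"
      have k: "?k i j \<in> {1..total}" if "i \<in> {1..I}" "j \<in> {1..n i}" for i j
        by (rule cell_number_in[of I \<pi> n i])
          (use \<pi> that(1) block_number_in[OF \<pi>[OF that(1)] that(2)] in simp_all)
      have "(\<forall>i\<in>{1..I}. \<forall>j\<in>{1..n i}. \<phi> (dstar n (\<lambda>i'. R i' \<omega>) i j) \<omega> \<in> A i j) \<longleftrightarrow>
          (\<forall>i\<in>{1..I}. \<forall>j\<in>{1..n i}. \<phi> (block_number P (?k i j)) \<omega> \<in> A i j)"
        using dstar_eq[OF \<omega>, of _ _ \<pi> P] that by simp
      also have "\<dots> \<longleftrightarrow> (\<forall>d\<in>{1..card P}. \<phi> d \<omega> \<in> ?G d)"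
      proof (intro iffI ballI)
        fix d assume *: "\<forall>i\<in>{1..I}. \<forall>j\<in>{1..n i}. \<phi> (block_number P (?k i j)) \<omega> \<in> A i j"
          and d: "d \<in> {1..card P}"
        show "\<phi> d \<omega> \<in> ?G d"
          using * in_block_iff[OF P d] d by (auto simp: cell_set_def)
      next
        fix i j assume *: "\<forall>d\<in>{1..card P}. \<phi> d \<omega> \<in> ?G d" and ij: "i \<in> {1..I}" "j \<in> {1..n i}"
        note b = block_number_in[OF P k[OF ij]] block_number_block[OF P k[OF ij]]
        have "\<phi> (block_number P (?k i j)) \<omega> \<in> cell_set I n A \<pi> (?k i j)"
          using bspec[OF * b(1)] b by simp
        then show "\<phi> (block_number P (?k i j)) \<omega> \<in> A i j"
          using ij by (simp add: cell_set_def)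
      qed
      finally show ?thesis .
    qed
    \<comment> \<open>\<open>\<pi>\<close> is extensional, so agreement on \<open>{1..I}\<close> is
      equality with the restricted function.\<close>
    have T_iff: "?T \<omega> = (\<pi>, P) \<longleftrightarrow> (\<forall>i\<in>{1..I}. R i \<omega> (n i) = \<pi> i) \<and> R 0 \<omega> total = P" for \<omega>
      using \<pi>E by (auto simp: fun_eq_iff PiE_def extensional_def restrict_def split: if_splits)
    have "E (\<pi>, P) = {\<omega> \<in> space \<Omega>. (\<forall>i\<in>{1..I}. R i \<omega> (n i) = \<pi> i) \<and> R 0 \<omega> total = P \<and>
        (\<forall>d\<in>{1..card P}. \<phi> d \<omega> \<in> ?G d)}"
      unfolding E_def vimage_def using T_iff iff by blast
    then have "measure \<Omega> (E (\<pi>, P)) = (\<Prod>i\<in>{1..I}. q (block_sizes (\<pi> i))) * q0 (block_sizes P) *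
        (\<Prod>d\<in>{1..card P}. measure H0 (?G d))"
      using prob_partitions_atoms[of \<pi> P total ?G "card P", OF \<pi> P n m G] by simp
    also have "(\<Prod>d\<in>{1..card P}. measure H0 (?G d)) =
        (\<Prod>d\<in>{1..card P}. measure H0 (\<Inter>k\<in>block P d. cell_set I n A \<pi> k))"
      by (intro prod.cong) auto
    also have "\<dots> = (\<Prod>B\<in>P. measure H0 (\<Inter>k\<in>B. cell_set I n A \<pi> k))"
      by (rule prod.reindex_bij_betw[OF bij_betw_block[OF P]])
    finally show ?thesis .
  qed
  have "?X = (\<Union>x\<in>?Q. E x)"
    using R_in_partitions by (auto simp: E_def)
  then have "measure \<Omega> ?X = measure \<Omega> (\<Union>x\<in>?Q. E x)"
    by simp
  also have "\<dots> = (\<Sum>x\<in>?Q. measure \<Omega> (E x))"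
  proof (rule \<Omega>.finite_measure_finite_Union[OF finQ])
    show "E ` ?Q \<subseteq> sets \<Omega>"
    proof (rule image_subsetI)
      fix x assume "x \<in> ?Q"
      then have "?T -` {x} \<inter> space \<Omega> \<in> sets \<Omega>"
        by (intro measurable_sets[OF measurable_levels]) simp
      then show "E x \<in> sets \<Omega>"
        unfolding E_def by (rule sets.Int[OF X])
    qed
    show "disjoint_family_on E ?Q"
      by (auto simp: disjoint_family_on_def E_def)
  qed
  also have "\<dots> = (\<Sum>\<pi>\<in>(\<Pi>\<^sub>E i\<in>{1..I}. partitions (n i)). \<Sum>P\<in>partitions total. measure \<Omega> (E (\<pi>, P)))"
    by (simp add: sum.cartesian_product)
  also have "\<dots> = (\<Sum>\<pi>\<in>(\<Pi>\<^sub>E i\<in>{1..I}. partitions (n i)). \<Sum>P\<in>partitions total.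
       (\<Prod>i\<in>{1..I}. q (block_sizes (\<pi> i))) * q0 (block_sizes P) *
       (\<Prod>B\<in>P. measure H0 (\<Inter>k\<in>B. cell_set I n A \<pi> k)))"
    by (intro sum.cong refl E_measure)
  finally show ?thesis .
qed

end

section \<open>From rectangles to laws\<close>

lemma distr_array_eqI:
  fixes X :: "nat \<Rightarrow> nat \<Rightarrow> 'a \<Rightarrow> 'x::topological_space" and Y :: "nat \<Rightarrow> nat \<Rightarrow> 'c \<Rightarrow> 'x"
  assumes M: "prob_space M" and \<Omega>: "prob_space \<Omega>"
    and X: "\<And>i j. i \<in> {1..I} \<Longrightarrow> j \<in> {1..n i} \<Longrightarrow> X i j \<in> measurable M borel"
    and Y: "\<And>i j. i \<in> {1..I} \<Longrightarrow> j \<in> {1..n i} \<Longrightarrow> Y i j \<in> measurable \<Omega> borel"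
    and eq: "\<And>A. (\<And>i j. A i j \<in> sets borel) \<Longrightarrow>
      measure M {\<omega> \<in> space M. \<forall>i\<in>{1..I}. \<forall>j\<in>{1..n i}. X i j \<omega> \<in> A i j} =
      measure \<Omega> {\<omega> \<in> space \<Omega>. \<forall>i\<in>{1..I}. \<forall>j\<in>{1..n i}. Y i j \<omega> \<in> A i j}"
  shows "distr M (\<Pi>\<^sub>M ij\<in>(SIGMA i:{1..I}. {1..n i}). borel)
           (\<lambda>\<omega>. \<lambda>(i, j)\<in>(SIGMA i:{1..I}. {1..n i}). X i j \<omega>) =
         distr \<Omega> (\<Pi>\<^sub>M ij\<in>(SIGMA i:{1..I}. {1..n i}). borel)
           (\<lambda>\<omega>. \<lambda>(i, j)\<in>(SIGMA i:{1..I}. {1..n i}). Y i j \<omega>)"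
    (is "distr M ?B ?X = distr \<Omega> ?B ?Y")
proof -
  interpret M: prob_space M by fact
  interpret \<Omega>: prob_space \<Omega> by fact
  let ?S = "SIGMA i:{1..I}. {1..n i}"
  have X_meas: "?X \<in> measurable M ?B" and Y_meas: "?Y \<in> measurable \<Omega> ?B"
    using X Y by (auto intro!: measurable_restrict)
  show ?thesis
  \<comment> \<open>Boxes generate the finite product and are stable under intersection. Both
    measures are finite, so the constant sequence \<open>space ?B\<close> serves as the exhausting
    sequence.\<close>
  proof (rule measure_eqI_PiM_finite[where I = ?S and M = "\<lambda>_. borel" and A = "\<lambda>_. space ?B"])
    show "finite ?S" by auto
    show "sets (distr M ?B ?X) = sets ?B" "sets (distr \<Omega> ?B ?Y) = sets ?B" by simp_all
    show "range (\<lambda>_. space ?B) \<subseteq> prod_algebra ?S (\<lambda>_. borel)"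
      by (auto simp: space_PiM intro!: prod_algebraI_finite)
    show "(\<Union>i::nat. space ?B) = space ?B" by simp
    show "emeasure (distr M ?B ?X) (space ?B) \<noteq> \<infinity>"
      using prob_space.emeasure_space_1[OF M.prob_space_distr[OF X_meas]] by simp
    fix A :: "nat \<times> nat \<Rightarrow> 'x set" assume A: "\<And>ij. ij \<in> ?S \<Longrightarrow> A ij \<in> sets borel"
    \<comment> \<open>\<open>eq\<close> asks for Borel sets at all pairs of indices, so the box is
      extended by the whole space outside the array.\<close>
    define A' where "A' i j = (if (i, j) \<in> ?S then A (i, j) else UNIV)" for i j
    have A': "A' i j \<in> sets borel" for i j
      using A by (auto simp: A'_def)
    have box: "Pi\<^sub>E ?S A \<in> sets ?B"
      using A by (intro sets_PiM_I_finite) auto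
    have "?X -` Pi\<^sub>E ?S A \<inter> space M = {\<omega> \<in> space M. \<forall>i\<in>{1..I}. \<forall>j\<in>{1..n i}. X i j \<omega> \<in> A' i j}"
      by (auto simp: A'_def PiE_iff)
    moreover have "?Y -` Pi\<^sub>E ?S A \<inter> space \<Omega> = {\<omega> \<in> space \<Omega>. \<forall>i\<in>{1..I}. \<forall>j\<in>{1..n i}. Y i j \<omega> \<in> A' i j}"
      by (auto simp: A'_def PiE_iff)
    ultimately show "emeasure (distr M ?B ?X) (Pi\<^sub>E ?S A) = emeasure (distr \<Omega> ?B ?Y) (Pi\<^sub>E ?S A)"
      by (simp only: emeasure_distr[OF X_meas box] emeasure_distr[OF Y_meas box]
          M.emeasure_eq_measure \<Omega>.emeasure_eq_measure eq[of A', OF A'])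
  qed
qed

theorem proposition4:
  fixes M :: "'a measure" and N :: "'b measure" and \<Omega> :: "'c measure"
    and H0 :: "'x::polish_space measure"
    and I :: nat and n :: "nat \<Rightarrow> nat"
    and q q0 :: "nat list \<Rightarrow> real"
    and p :: "'b \<Rightarrow> 'x measure"
    and \<xi> :: "nat \<Rightarrow> nat \<Rightarrow> 'a \<Rightarrow> 'x"
    and \<phi> :: "nat \<Rightarrow> 'c \<Rightarrow> 'x"
    and R :: "nat \<Rightarrow> 'c \<Rightarrow> nat \<Rightarrow> nat set set"
  assumes "prob_space M" and "prob_space N" and "prob_space \<Omega>"
    and "prob_space H0" and "sets H0 = sets borel"
    and "HSSM M I \<xi> N p q q0 H0"
    and "\<forall>i\<in>{1..I}. 1 \<le> n i"
    and "\<forall>k\<ge>1. \<phi> k \<in> measurable \<Omega> borel \<and> distr \<Omega> borel (\<phi> k) = H0"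
    and "\<forall>i\<in>{1..I}. has_EPPF \<Omega> (R i) q"
    and "has_EPPF \<Omega> (R 0) q0"
    and "prob_space.indep_sets \<Omega>
           (case_sum (\<lambda>k. gen_events \<Omega> borel (\<phi> k)) (\<lambda>i. gen_events \<Omega> partition_space (R i)))
           ({1..} <+> {0..I})"
  shows "distr M (\<Pi>\<^sub>M ij\<in>(SIGMA i:{1..I}. {1..n i}). borel)
           (\<lambda>\<omega>. \<lambda>(i, j)\<in>(SIGMA i:{1..I}. {1..n i}). \<xi> i j \<omega>) =
         distr \<Omega> (\<Pi>\<^sub>M ij\<in>(SIGMA i:{1..I}. {1..n i}). borel)
           (\<lambda>\<omega>. \<lambda>(i, j)\<in>(SIGMA i:{1..I}. {1..n i}). \<phi> (dstar n (\<lambda>i'. R i' \<omega>) i j) \<omega>)"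
proof (rule distr_array_eqI)
  note ctx = assms(3,8-11)
  have n: "1 \<le> n i" if "i \<in> {1..I}" for i
    using assms(7) that by blast
  show "\<xi> i j \<in> measurable M borel" if "i \<in> {1..I}" "j \<in> {1..n i}" for i j
    using assms(6) that by (simp add: HSSM_def)
  show "(\<lambda>\<omega>. \<phi> (dstar n (\<lambda>i'. R i' \<omega>) i j) \<omega>) \<in> measurable \<Omega> borel"
    if "i \<in> {1..I}" "j \<in> {1..n i}" for i j
    using that by (rule measurable_dstar[OF ctx])
  fix A :: "nat \<Rightarrow> nat \<Rightarrow> 'x set" assume A: "\<And>i j. A i j \<in> sets borel"
  show "measure M {\<omega> \<in> space M. \<forall>i\<in>{1..I}. \<forall>j\<in>{1..n i}. \<xi> i j \<omega> \<in> A i j} =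
      measure \<Omega> {\<omega> \<in> space \<Omega>. \<forall>i\<in>{1..I}. \<forall>j\<in>{1..n i}. \<phi> (dstar n (\<lambda>i'. R i' \<omega>) i j) \<omega> \<in> A i j}"
  \<comment> \<open>With no groups both events are whole spaces of probability 1. Otherwise the
    total sample size is positive, as the moment formula requires.\<close>
  proof (cases "I = 0")
    case True
    then show ?thesis
      using assms(1,3) by (simp add: prob_space.prob_space)
  next
    case False
    then have I: "1 \<le> I" by simp
    show ?thesis
      using HSSM_rectangle[OF assms(2,4,6) I n A] dstar_rectangle[OF ctx I n A] by simp
  qed
qed (use assms in auto)

end
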